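(* Let $X$ be a reflexive Banach space, $Y$ a Banach space, and $(L_n)_{n=1}^\infty$ a sequence of bounded linear operators $L_n:X\to Y$. Let $$E=\{x\in X:\sup_n\|L_nx\|_Y<\infty\},\qquad \|x\|_E=\sup_n\|L_nx\|_Y .$$ Suppose that $\|\cdot\|_E$ is a norm under which $E$ is a Banach space, that $E$ is continuously contained in $X$, and that $E$ is dense in $X$ in the $X$-norm. Let $$P=\Big\{(y_n^\ast)\in\ell^1(Y^\ast):\ \sum_{n=1}^\infty y_n^\ast(L_nx)=0\ \text{ for all }x\in E\Big\}.$$ Then $E$ has an isometric predual $$E_\ast=\ell^1(Y^\ast)/P .$$ That is, every $x\in E$ corresponds to a functional on $\ell^1(Y^\ast)/P$ given by $$x((y_n^\ast))=\sum_{n=1}^\infty y_n^\ast(L_nx)=\sum_{n=1}^\infty L_n^\ast y_n^\ast(x),\qquad (y_n^\ast)\in\ell^1(Y^\ast),\qquad (1)$$ and conversely every bounded functional on $\ell^1(Y^\ast)/P$ is given by a unique $x\in E$ according to (1). The norm of $x$ as a functional on $\ell^1(Y^\ast)/P$ is equal to its norm as an element of $E$.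
   Context: $\ell^1(Y^\ast)$ is the Banach space of sequences $(y_n^\ast)_{n\ge1}$ in $Y^\ast$ with $\|(y_n^\ast)\|_{\ell^1(Y^\ast)}=\sum_n\|y_n^\ast\|_{Y^\ast}<\infty$, and $\ell^1(Y^\ast)/P$ carries the quotient norm. $L_n^\ast:Y^\ast\to X^\ast$ is the Banach space adjoint of $L_n$. *)

theory Defs
  imports "HOL-Analysis.Analysis" "HOL-Library.Function_Algebras" "HOL-Library.Set_Algebras"
begin

text \<open>
  The scalar field is a type \<open>'k\<close> of sort \<open>{real_normed_field, euclidean_space}\<close>. Finite-dimensional
  commutative real division algebras are isomorphic to the reals or the complex numbers, and the
  multiplicative norm is then the usual absolute value, so \<^typ>\<open>real\<close> and \<^typ>\<open>complex\<close> are, up to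
  isometric isomorphism, exactly the fields covered.

  The class \<^class>\<open>banach\<close> only knows real scalars; a Banach space over \<open>'k\<close> is a type of that class
  together with a scalar multiplication by \<open>'k\<close> that extends the real one. For \<open>'k = real\<close> it
  is \<^const>\<open>scaleR\<close>.
\<close>

locale scalar_banach = vector_space scale
  for scale :: "'k::{real_normed_field,euclidean_space} \<Rightarrow> 'v::banach \<Rightarrow> 'v" +
  assumes scale_of_real: "scale (of_real r) v = r *\<^sub>R v"
    and norm_scale: "norm (scale c v) = norm c * norm v"

definition scalar_linear ::
    "('k::{real_normed_field,euclidean_space} \<Rightarrow> 'v \<Rightarrow> 'v) \<Rightarrow> ('k \<Rightarrow> 'w \<Rightarrow> 'w)
     \<Rightarrow> 'v::real_normed_vector \<Rightarrow>\<^sub>L 'w::real_normed_vector \<Rightarrow> bool"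
  where "scalar_linear s t T \<longleftrightarrow> (\<forall>c v. T (s c v) = t c (T v))"

definition topdual ::
    "('k::{real_normed_field,euclidean_space} \<Rightarrow> 'v \<Rightarrow> 'v) \<Rightarrow> ('v::real_normed_vector \<Rightarrow>\<^sub>L 'k) set"
  where "topdual s = {f. scalar_linear s (*) f}"

definition dscale ::
    "'k::{real_normed_field,euclidean_space} \<Rightarrow> 'v::real_normed_vector \<Rightarrow>\<^sub>L 'k \<Rightarrow> 'v \<Rightarrow>\<^sub>L 'k"
  where "dscale c f = blinfun_mult_right c o\<^sub>L f"

definition adjoint_op ::
    "'v::real_normed_vector \<Rightarrow>\<^sub>L 'w::real_normed_vector \<Rightarrow> 'w \<Rightarrow>\<^sub>L 'k::real_normed_vector \<Rightarrow> 'v \<Rightarrow>\<^sub>L 'k"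
  where "adjoint_op T f = f o\<^sub>L T"


text \<open>
  Normed spaces whose carrier is a set, needed for subspaces with a norm of their own, for quotients
  and for their duals. The zero vector is not assumed to be the zero of the ambient type: cosets
  are added as sets, and the zero of a quotient by \<open>P\<close> is \<open>P\<close>, not \<open>{0}\<close>.
\<close>

locale normed_space_on =
  fixes V :: "'v::ab_semigroup_add set"
    and scl :: "'k::real_normed_field \<Rightarrow> 'v \<Rightarrow> 'v"
    and N :: "'v \<Rightarrow> real"
  assumes add_closed: "\<lbrakk>u \<in> V; v \<in> V\<rbrakk> \<Longrightarrow> u + v \<in> V"
    and scl_closed: "v \<in> V \<Longrightarrow> scl c v \<in> V"
    and zero_ex: "\<exists>z\<in>V. (\<forall>v\<in>V. z + v = v \<and> v + scl (-1) v = z \<and> (N v = 0 \<longleftrightarrow> v = z))"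
    and scl_add_right: "\<lbrakk>u \<in> V; v \<in> V\<rbrakk> \<Longrightarrow> scl c (u + v) = scl c u + scl c v"
    and scl_add_left: "v \<in> V \<Longrightarrow> scl (c + d) v = scl c v + scl d v"
    and scl_scl: "v \<in> V \<Longrightarrow> scl c (scl d v) = scl (c * d) v"
    and scl_one: "v \<in> V \<Longrightarrow> scl 1 v = v"
    and N_nonneg: "v \<in> V \<Longrightarrow> 0 \<le> N v"
    and N_scl: "v \<in> V \<Longrightarrow> N (scl c v) = norm c * N v"
    and N_triangle: "\<lbrakk>u \<in> V; v \<in> V\<rbrakk> \<Longrightarrow> N (u + v) \<le> N u + N v"

locale banach_space_on = normed_space_on +
  assumes complete:
    "\<lbrakk>\<And>n. u n \<in> V; \<And>e. e > 0 \<Longrightarrow> \<exists>M. \<forall>m\<ge>M. \<forall>n\<ge>M. N (u m + scl (-1) (u n)) < e\<rbrakk>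
     \<Longrightarrow> \<exists>v\<in>V. (\<lambda>n. N (u n + scl (-1) v)) \<longlonglongrightarrow> 0"

text \<open>Functionals are set to \<open>0\<close> off the carrier, so that distinct elements of \<open>dual_on\<close> are distinct
  as functionals on \<open>V\<close>.\<close>

definition dual_on ::
    "'v::plus set \<Rightarrow> ('k::real_normed_field \<Rightarrow> 'v \<Rightarrow> 'v) \<Rightarrow> ('v \<Rightarrow> real) \<Rightarrow> ('v \<Rightarrow> 'k) set"
  where "dual_on V scl N = {\<phi>.
     (\<forall>u\<in>V. \<forall>v\<in>V. \<phi> (u + v) = \<phi> u + \<phi> v) \<and>
     (\<forall>c. \<forall>v\<in>V. \<phi> (scl c v) = c * \<phi> v) \<and>
     (\<exists>B. \<forall>v\<in>V. norm (\<phi> v) \<le> B * N v) \<and>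
     (\<forall>v. v \<notin> V \<longrightarrow> \<phi> v = 0)}"

definition dual_norm_on :: "'v set \<Rightarrow> ('v \<Rightarrow> real) \<Rightarrow> ('v \<Rightarrow> 'k::real_normed_field) \<Rightarrow> real"
  where "dual_norm_on V N \<phi> = (SUP v\<in>{v\<in>V. N v \<le> 1}. norm (\<phi> v))"

definition isometric_iso_on ::
    "'v::plus set \<Rightarrow> ('k \<Rightarrow> 'v \<Rightarrow> 'v) \<Rightarrow> ('v \<Rightarrow> real)
     \<Rightarrow> 'w::plus set \<Rightarrow> ('k \<Rightarrow> 'w \<Rightarrow> 'w) \<Rightarrow> ('w \<Rightarrow> real) \<Rightarrow> ('v \<Rightarrow> 'w) \<Rightarrow> bool"
  where "isometric_iso_on V s N W t M J \<longleftrightarrow>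
     bij_betw J V W \<and>
     (\<forall>u\<in>V. \<forall>v\<in>V. J (u + v) = J u + J v) \<and>
     (\<forall>c. \<forall>v\<in>V. J (s c v) = t c (J v)) \<and>
     (\<forall>v\<in>V. M (J v) = N v)"

text \<open>Surjectivity of the canonical map into the bidual.\<close>

definition reflexive_space ::
    "('k::{real_normed_field,euclidean_space} \<Rightarrow> 'v \<Rightarrow> 'v::real_normed_vector) \<Rightarrow> bool"
  where "reflexive_space s \<longleftrightarrow>
     (\<forall>\<Phi>\<in>dual_on (topdual s) dscale norm. \<exists>x. \<forall>f\<in>topdual s. \<Phi> f = blinfun_apply f x)"


definition quot_space :: "'v::plus set \<Rightarrow> 'v set \<Rightarrow> 'v set set"
  where "quot_space V P = (\<lambda>v. v +o P) ` V"

text \<open>The summand \<open>P\<close> matters only for \<open>c = 0\<close>, where the image alone would be \<open>{0}\<close>.\<close>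

definition quot_scale :: "('k \<Rightarrow> 'v \<Rightarrow> 'v) \<Rightarrow> 'v::plus set \<Rightarrow> 'k \<Rightarrow> 'v set \<Rightarrow> 'v set"
  where "quot_scale scl P c A = scl c ` A + P"

definition quot_norm :: "('v \<Rightarrow> real) \<Rightarrow> 'v set \<Rightarrow> real"
  where "quot_norm N A = (INF v\<in>A. N v)"


definition ell1 :: "'v::real_normed_vector set \<Rightarrow> (nat \<Rightarrow> 'v) set"
  where "ell1 A = {y. (\<forall>n. y n \<in> A) \<and> summable (\<lambda>n. norm (y n))}"

definition ell1_norm :: "(nat \<Rightarrow> 'v::real_normed_vector) \<Rightarrow> real"
  where "ell1_norm y = (\<Sum>n. norm (y n))"

definition ell1_scale :: "('k \<Rightarrow> 'v \<Rightarrow> 'v) \<Rightarrow> 'k \<Rightarrow> (nat \<Rightarrow> 'v) \<Rightarrow> nat \<Rightarrow> 'v"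
  where "ell1_scale scl c y = (\<lambda>n. scl c (y n))"


definition E_space :: "(nat \<Rightarrow> 'x::real_normed_vector \<Rightarrow>\<^sub>L 'y::real_normed_vector) \<Rightarrow> 'x set"
  where "E_space L = {x. bdd_above (range (\<lambda>n. norm (L n x)))}"

definition E_norm :: "(nat \<Rightarrow> 'x::real_normed_vector \<Rightarrow>\<^sub>L 'y::real_normed_vector) \<Rightarrow> 'x \<Rightarrow> real"
  where "E_norm L x = (SUP n. norm (L n x))"

definition P_space ::
    "('k::{real_normed_field,euclidean_space} \<Rightarrow> 'y \<Rightarrow> 'y)
     \<Rightarrow> (nat \<Rightarrow> 'x::real_normed_vector \<Rightarrow>\<^sub>L 'y::real_normed_vector) \<Rightarrow> (nat \<Rightarrow> 'y \<Rightarrow>\<^sub>L 'k) set"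
  where "P_space sY L = {y \<in> ell1 (topdual sY). \<forall>x\<in>E_space L. (\<lambda>n. y n (L n x)) sums 0}"

definition predual ::
    "('k::{real_normed_field,euclidean_space} \<Rightarrow> 'y \<Rightarrow> 'y)
     \<Rightarrow> (nat \<Rightarrow> 'x::real_normed_vector \<Rightarrow>\<^sub>L 'y::real_normed_vector) \<Rightarrow> (nat \<Rightarrow> 'y \<Rightarrow>\<^sub>L 'k) set set"
  where "predual sY L = quot_space (ell1 (topdual sY)) (P_space sY L)"

definition predual_scale ::
    "('k::{real_normed_field,euclidean_space} \<Rightarrow> 'y \<Rightarrow> 'y)
     \<Rightarrow> (nat \<Rightarrow> 'x::real_normed_vector \<Rightarrow>\<^sub>L 'y::real_normed_vector)
     \<Rightarrow> 'k \<Rightarrow> (nat \<Rightarrow> 'y \<Rightarrow>\<^sub>L 'k) set \<Rightarrow> (nat \<Rightarrow> 'y \<Rightarrow>\<^sub>L 'k) set"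
  where "predual_scale sY L = quot_scale (ell1_scale dscale) (P_space sY L)"

end

theory Submission
  imports Defs
begin

text \<open>
  Restricting a bounded functional \<open>\<phi>\<close> on the quotient to \<open>X\<^sup>*\<close> and using reflexivity produces the
  point \<open>x\<close>. The restriction makes sense because every \<open>f \<in> X\<^sup>*\<close> agrees on \<open>E\<close> with the functional of
  some \<open>y \<in> \<ell>\<^sup>1(Y\<^sup>*)\<close> of norm at most \<open>4 C \<parallel>f\<parallel>\<close>, where \<open>C\<close> is the norm of the embedding of \<open>E\<close> into
  \<open>X\<close>: by Hahn--Banach and reflexivity the seminorm
  \<open>p f = inf (\<parallel>y\<parallel> + 4 C \<parallel>f - h\<parallel>)\<close>, over all \<open>h \<in> X\<^sup>*\<close> represented by \<open>y\<close>, equals \<open>\<bar>f x\<bar>\<close> for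
  some \<open>x\<close> with \<open>\<parallel>L\<^sub>n x\<parallel> \<le> 1\<close> for all \<open>n\<close>, so \<open>p f \<le> C \<parallel>f\<parallel>\<close>. Hence \<open>f\<close> is represented up to an
  error of norm at most \<open>\<parallel>f\<parallel> / 2\<close>, and iterating gives a geometric series. The identity
  \<open>\<phi> (L\<^sub>n\<^sup>* y\<^sup>*) = y\<^sup>* (L\<^sub>n x)\<close> then shows that \<open>x \<in> E\<close> and that \<open>x\<close> induces \<open>\<phi>\<close>.
\<close>

section \<open>The Hahn--Banach theorem\<close>

definition sublinear :: "('a::real_vector \<Rightarrow> real) \<Rightarrow> bool"
  where "sublinear p \<longleftrightarrow> (\<forall>x y. p (x + y) \<le> p x + p y) \<and> (\<forall>r\<ge>0. \<forall>x. p (r *\<^sub>R x) = r * p x)"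

lemma sublinearI:
  assumes "\<And>x y. p (x + y) \<le> p x + p y" and "\<And>r x. r \<ge> 0 \<Longrightarrow> p (r *\<^sub>R x) = r * p x"
  shows "sublinear p"
  using assms by (simp add: sublinear_def)

lemma sublinear_add: "sublinear p \<Longrightarrow> p (x + y) \<le> p x + p y"
  and sublinear_scale: "sublinear p \<Longrightarrow> r \<ge> 0 \<Longrightarrow> p (r *\<^sub>R x) = r * p x"
  by (auto simp: sublinear_def)

lemma sublinear_0: "sublinear p \<Longrightarrow> p 0 = 0"
  using sublinear_scale[of p 0 0] by simp

lemma sublinear_minus: "sublinear p \<Longrightarrow> - p (- x) \<le> p x"
  using sublinear_add[of p x "- x"] sublinear_0[of p] by simp

text \<open>
  Instead of extending functionals, the proof descends in the set of sublinear functionals: the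
  lemma below shows that a minimal one is additive, hence linear, and also yields equality at the
  prescribed point.
\<close>

lemma sublinear_descent:
  fixes q :: "'a::real_vector \<Rightarrow> real"
  assumes q: "sublinear q"
  obtains q' where "sublinear q'" "q' \<le> q" "\<And>x. q' x \<le> q (x + a) - q a"
proof -
  \<comment> \<open>The functional \<open>q'\<close> is the largest sublinear one below
    \<open>q\<close> whose value at \<open>- a\<close> is at most \<open>- q a\<close>. The
    parameters t = 0 and t = 1 give the last two claims. The set is bounded below by
    \<open>- q (- x)\<close> because t q(a) = q(t a) \<le> q(x + t a) + q(-x).\<close>
  define S where "S x = (\<lambda>t. q (x + t *\<^sub>R a) - t * q a) ` {0..}" for x
  define q' where "q' x = Inf (S x)" for x
  have bdd: "bdd_below (S x)" for x
  proof (rule bdd_belowI)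
    fix z assume "z \<in> S x"
    then obtain t where t: "t \<ge> 0" "z = q (x + t *\<^sub>R a) - t * q a" by (auto simp: S_def)
    show "- q (- x) \<le> z"
      using sublinear_add[OF q, of "x + t *\<^sub>R a" "- x"] sublinear_scale[OF q t(1), of a] t(2) by simp
  qed
  have le: "q' x \<le> q (x + t *\<^sub>R a) - t * q a" if "t \<ge> 0" for x t
    unfolding q'_def using that by (intro cInf_lower bdd) (auto simp: S_def)
  have ge: "c \<le> q' x" if "\<And>t. t \<ge> 0 \<Longrightarrow> c \<le> q (x + t *\<^sub>R a) - t * q a" for x c
    unfolding q'_def using that by (intro cInf_greatest) (auto simp: S_def)
  have add: "q' (x + y) \<le> q' x + q' y" for x y
  proof -
    have "q' (x + y) - (q (x + t *\<^sub>R a) - t * q a) \<le> q' y" if t: "t \<ge> 0" for t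
    proof (rule ge)
      fix s :: real assume s: "s \<ge> 0"
      have "q' (x + y) \<le> q ((x + y) + (t + s) *\<^sub>R a) - (t + s) * q a"
        using s t by (intro le) simp
      also have "(x + y) + (t + s) *\<^sub>R a = (x + t *\<^sub>R a) + (y + s *\<^sub>R a)"
        by (simp add: algebra_simps)
      finally show "q' (x + y) - (q (x + t *\<^sub>R a) - t * q a) \<le> q (y + s *\<^sub>R a) - s * q a"
        using sublinear_add[OF q, of "x + t *\<^sub>R a" "y + s *\<^sub>R a"] by (simp add: algebra_simps)
    qed
    then have "q' (x + y) - q' y \<le> q' x"
      by (intro ge) (simp add: algebra_simps)
    then show ?thesis by simp
  qed
  have scale_le: "q' (r *\<^sub>R x) \<le> r * q' x" if r: "r > 0" for r x
  proof -
    have "q' (r *\<^sub>R x) / r \<le> q' x"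
    proof (rule ge)
      fix t :: real assume t: "t \<ge> 0"
      have "q' (r *\<^sub>R x) \<le> q (r *\<^sub>R x + (r * t) *\<^sub>R a) - (r * t) * q a"
        using r t by (intro le) simp
      also have "r *\<^sub>R x + (r * t) *\<^sub>R a = r *\<^sub>R (x + t *\<^sub>R a)"
        by (simp add: algebra_simps)
      finally have "q' (r *\<^sub>R x) \<le> r * (q (x + t *\<^sub>R a) - t * q a)"
        using sublinear_scale[OF q, of r] r by (simp add: right_diff_distrib mult.assoc)
      then show "q' (r *\<^sub>R x) / r \<le> q (x + t *\<^sub>R a) - t * q a"
        using r by (simp add: field_simps)
    qed
    then show ?thesis using r by (simp add: field_simps)
  qed
  have "q' 0 = 0"
  proof (rule antisym)
    show "q' 0 \<le> 0" using le[of 0 0] sublinear_0[OF q] by simp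
    show "0 \<le> q' 0" by (rule ge) (simp add: sublinear_scale[OF q])
  qed
  have scale: "q' (r *\<^sub>R x) = r * q' x" if r: "r \<ge> 0" for r x
  proof (cases "r = 0")
    case False
    with r have r: "r > 0" by simp
    \<comment> \<open>The reverse inequality is \<open>scale_le\<close> for the factor
      \<open>inverse r\<close> at the point r x.\<close>
    have "q' (inverse r *\<^sub>R r *\<^sub>R x) \<le> inverse r * q' (r *\<^sub>R x)"
      using r by (intro scale_le) simp
    then have "r * q' x \<le> q' (r *\<^sub>R x)"
      using r by (simp add: field_simps)
    with scale_le[OF r, of x] show ?thesis by simp
  qed (simp add: \<open>q' 0 = 0\<close>)
  show thesis
  proof
    show "sublinear q'" by (intro sublinearI add scale)
    show "q' \<le> q" using le[of 0] by (simp add: le_fun_def)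
    show "q' x \<le> q (x + a) - q a" for x using le[of 1 x] by simp
  qed
qed

text \<open>The pointwise infimum works: two members used at different points can both be replaced
  by the smaller one, which gives subadditivity. This supplies the lower bounds that Zorn's lemma
  asks for.\<close>

lemma sublinear_INF_chain:
  fixes C :: "('a::real_vector \<Rightarrow> real) set"
  assumes "C \<noteq> {}" and sub: "\<And>q. q \<in> C \<Longrightarrow> sublinear q"
    and chain: "\<And>q r. q \<in> C \<Longrightarrow> r \<in> C \<Longrightarrow> q \<le> r \<or> r \<le> q"
  obtains u where "sublinear u" "\<And>q. q \<in> C \<Longrightarrow> u \<le> q"
proof -
  define u where "u x = (INF q\<in>C. q x)" for x
  obtain q0 where q0: "q0 \<in> C" using \<open>C \<noteq> {}\<close> by blast
  have bdd: "bdd_below ((\<lambda>q. q x) ` C)" for x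
  proof (rule bdd_belowI)
    fix z assume "z \<in> (\<lambda>q. q x) ` C"
    then obtain q where q: "q \<in> C" "z = q x" by auto
    \<comment> \<open>One fixed member bounds all others from below: if q \<le> q0 then -q0(-x)
      \<le> -q(-x) \<le> q(x), and if q0 \<le> q then -q0(-x) \<le> q0(x) \<le> q(x).\<close>
    have "- q0 (- x) \<le> q x" if "q \<le> q0"
      using sublinear_minus[OF sub[OF q(1)], of x] le_funD[OF that, of "- x"] by simp
    moreover have "- q0 (- x) \<le> q x" if "q0 \<le> q"
      using sublinear_minus[OF sub[OF q0], of x] le_funD[OF that, of x] by simp
    ultimately show "- q0 (- x) \<le> z" using chain[OF q(1) q0] q(2) by auto
  qed
  have le: "u x \<le> q x" if "q \<in> C" for q x
    unfolding u_def using that by (intro cINF_lower bdd)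
  have ge: "c \<le> u x" if "\<And>q. q \<in> C \<Longrightarrow> c \<le> q x" for c x
    unfolding u_def using that \<open>C \<noteq> {}\<close> by (intro cINF_greatest)
  have add: "u (x + y) \<le> u x + u y" for x y
  proof -
    have "u (x + y) - q x \<le> u y" if q: "q \<in> C" for q
    proof (rule ge)
      fix r assume r: "r \<in> C"
      have "u (x + y) \<le> q x + q y" "u (x + y) \<le> r x + r y"
        using le[OF q, of "x + y"] le[OF r, of "x + y"]
          sublinear_add[OF sub[OF q], of x y] sublinear_add[OF sub[OF r], of x y] by linarith+
      moreover have "q y \<le> r y \<or> r x \<le> q x"
        using chain[OF q r] by (auto simp: le_fun_def)
      ultimately show "u (x + y) - q x \<le> r y" by linarith
    qed
    then have "u (x + y) - u y \<le> u x" by (intro ge) (simp add: algebra_simps)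
    then show ?thesis by simp
  qed
  have scale_le: "u (r *\<^sub>R x) \<le> r * u x" if r: "r > 0" for r x
  proof -
    have "u (r *\<^sub>R x) / r \<le> u x"
      using le[of _ "r *\<^sub>R x"] r by (intro ge) (simp add: sublinear_scale[OF sub] field_simps)
    then show ?thesis using r by (simp add: field_simps)
  qed
  have "u 0 = 0"
    using le[OF q0, of 0] ge[of 0 0] by (simp add: sublinear_0[OF sub] q0)
  have scale: "u (r *\<^sub>R x) = r * u x" if r: "r \<ge> 0" for r x
  proof (cases "r = 0")
    case False
    with r have r: "r > 0" by simp
    have "u (inverse r *\<^sub>R r *\<^sub>R x) \<le> inverse r * u (r *\<^sub>R x)"
      using r by (intro scale_le) simp
    then have "r * u x \<le> u (r *\<^sub>R x)"
      using r by (simp add: field_simps)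
    with scale_le[OF r, of x] show ?thesis by simp
  qed (simp add: \<open>u 0 = 0\<close>)
  show thesis
  proof
    show "sublinear u" by (intro sublinearI add scale)
    show "u \<le> q" if "q \<in> C" for q using le[OF that] by (simp add: le_fun_def)
  qed
qed

theorem hahn_banach_sublinear:
  fixes p :: "'a::real_vector \<Rightarrow> real"
  assumes p: "sublinear p"
  obtains f where "linear f" "\<And>x. f x \<le> p x" "f a = p a"
proof -
  \<comment> \<open>Zorn's lemma is used below \<open>q0\<close> instead of \<open>p\<close>.
    Everything below \<open>q0\<close> inherits the bound -p(a) at the point -a, and for a linear
    functional below \<open>p\<close> this forces the value p(a) at a.\<close>
  obtain q0 where q0: "sublinear q0" "q0 \<le> p" "\<And>x. q0 x \<le> p (x + a) - p a"
    using sublinear_descent[OF p, of a] by blast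
  define A where "A = {q. sublinear q \<and> q \<le> q0}"
  have "\<exists>m\<in>A. \<forall>q\<in>A. q \<le> m \<longrightarrow> q = m"
  \<comment> \<open>The order is reversed, so a maximal element is a minimal sublinear functional
    and chains need lower bounds.\<close>
  proof (rule predicate_Zorn)
    show "partial_order_on A (relation_of (\<lambda>q r. r \<le> q) A)"
      by (intro partial_order_on_relation_ofI) auto
  next
    fix C assume C: "C \<in> Chains (relation_of (\<lambda>q r. r \<le> q) A)"
    then have CA: "C \<subseteq> A" using Chains_relation_of by blast
    show "\<exists>u\<in>A. \<forall>q\<in>C. u \<le> q"
    proof (cases "C = {}")
      case True
      then show ?thesis using q0 by (auto simp: A_def)
    next
      case False
      obtain u where u: "sublinear u" "\<And>q. q \<in> C \<Longrightarrow> u \<le> q"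
        using False
      proof (rule sublinear_INF_chain)
        show "sublinear q" if "q \<in> C" for q using CA that by (auto simp: A_def)
        show "q \<le> r \<or> r \<le> q" if "q \<in> C" "r \<in> C" for q r
          using C that by (auto simp: Chains_def relation_of_def)
      qed blast
      from False obtain q where "q \<in> C" by blast
      with u CA have "u \<le> q" "q \<le> q0" by (auto simp: A_def)
      with u(1) have "u \<in> A" by (simp add: A_def)
      with u show ?thesis by blast
    qed
  qed
  then obtain f where f: "sublinear f" "f \<le> q0" and A: "\<forall>q\<in>A. q \<le> f \<longrightarrow> q = f"
    by (auto simp: A_def)
  have min: "q = f" if "sublinear q" "q \<le> f" for q
    using A f(2) that by (simp add: A_def order_trans[of q f])
  have add: "f (x + y) = f x + f y" for x y
  proof (rule antisym)
    \<comment> \<open>By minimality, descending from \<open>f\<close> in the direction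
      \<open>y\<close> gives \<open>f\<close> again. So \<open>f\<close> satisfies the descent
      inequality itself, which is superadditivity.\<close>
    obtain q where q: "sublinear q" "q \<le> f" "\<And>x. q x \<le> f (x + y) - f y"
      using sublinear_descent[OF f(1), of y] by blast
    have "f x \<le> f (x + y) - f y" using q(3)[of x] min[OF q(1,2)] by simp
    then show "f x + f y \<le> f (x + y)" by simp
  qed (rule sublinear_add[OF f(1)])
  have minus: "f (- x) = - f x" for x
    using add[of x "- x"] sublinear_0[OF f(1)] by simp
  show thesis
  proof
    show "linear f"
    proof (rule linearI)
      show "f (r *\<^sub>R x) = r *\<^sub>R f x" for r x
        using sublinear_scale[OF f(1), of r x] sublinear_scale[OF f(1), of "- r" x] minus[of "r *\<^sub>R x"]
        by (cases "r \<ge> 0") auto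
    qed (rule add)
    show le: "f x \<le> p x" for x using le_funD[OF f(2), of x] le_funD[OF q0(2), of x] by linarith
    have "f (- a) \<le> - p a"
      using le_funD[OF f(2), of "- a"] q0(3)[of "- a"] sublinear_0[OF p] by simp
    with le[of a] minus[of a] show "f a = p a" by simp
  qed
qed

section \<open>Functionals with values in the scalar field\<close>

lemma inner_one_le_norm: "(a::'k::{real_normed_field,euclidean_space}) \<bullet> 1 \<le> norm a"
  using norm_cauchy_schwarz[of a 1] by simp

lemma inner_one_one: "(1::'k::{real_normed_field,euclidean_space}) \<bullet> 1 = 1"
  using norm_eq_1[of "1::'k"] by simp

text \<open>
  \<open>\<lambda>a. a \<bullet> 1\<close> plays the role of the real part, without classifying the scalar fields: all that is
  needed is that the form \<open>(c, d) \<mapsto> (c * d) \<bullet> 1\<close> is nondegenerate.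
\<close>

lemma functional_eq_inner_one_mult:
  fixes g :: "'k::{real_normed_field,euclidean_space} \<Rightarrow> real"
  assumes g: "linear g"
  obtains d where "\<And>c. g c = (c * d) \<bullet> 1"
proof -
  \<comment> \<open>\<open>A d\<close> is the Riesz representer of c \<mapsto> (c * d) \<bullet> 1.
    For d \<noteq> 0 it is nonzero, as the test c = inverse d shows, so \<open>A\<close> is
    injective and, the dimension being finite, surjective.\<close>
  define A :: "'k \<Rightarrow> 'k" where "A d = adjoint (\<lambda>c. c * d) 1" for d
  have A: "c \<bullet> A d = (c * d) \<bullet> 1" for c d
    unfolding A_def by (intro adjoint_works bounded_linear.linear bounded_linear_mult_left)
  have "linear A"
  proof (rule linearI)
    show "A (x + y) = A x + A y" for x y
      by (rule vector_eq_ldot[THEN iffD1]) (simp add: A inner_add_right inner_add_left distrib_left)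
    show "A (r *\<^sub>R x) = r *\<^sub>R A x" for r x
      by (rule vector_eq_ldot[THEN iffD1]) (simp add: A)
  qed
  moreover have "inj A"
  proof (subst linear_injective_0[OF \<open>linear A\<close>], intro allI impI)
    fix d assume "A d = 0"
    then have "(inverse d * d) \<bullet> 1 = 0" using A[of "inverse d" d] by simp
    then show "d = 0" by (cases "d = 0") auto
  qed
  ultimately have "surj A" by (rule linear_inj_imp_surj)
  \<comment> \<open>\<open>adjoint g 1\<close> is the Riesz representer of \<open>g\<close>.\<close>
  then obtain d where d: "adjoint g 1 = A d" by (metis surjD)
  have "g c = (c * d) \<bullet> 1" for c
    using adjoint_works[OF g, of c 1] d A[of c d] by simp
  then show thesis by (rule that)
qed

text \<open>Nondegeneracy of the form, tested with c = inverse (a - b). Identities between scalars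
  can thus be checked on the real parts of all their multiples.\<close>

lemma inner_one_mult_eqD:
  fixes a b :: "'k::{real_normed_field,euclidean_space}"
  assumes "\<And>c. (c * a) \<bullet> 1 = (c * b) \<bullet> 1"
  shows "a = b"
proof (rule ccontr)
  assume "a \<noteq> b"
  then have "(inverse (a - b) * (a - b)) \<bullet> 1 = 1" by (simp add: inner_one_one)
  moreover have "(inverse (a - b) * (a - b)) \<bullet> 1 = 0"
    unfolding right_diff_distrib inner_diff_left assms by simp
  ultimately show False by simp
qed

text \<open>A real functional \<open>g\<close> below \<open>p\<close> with g(a) = p(a) becomes the
  real part of \<open>F\<close>: for fixed v the map c \<mapsto> g(c v) is real-linear on the
  scalars, hence of the form c \<mapsto> (c * F v) \<bullet> 1. Over the complex numbers this is the
  formula F(v) = g(v) - i g(i v).\<close>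

theorem hahn_banach_seminorm:
  fixes s :: "'k::{real_normed_field,euclidean_space} \<Rightarrow> 'v::real_vector \<Rightarrow> 'v"
  assumes "vector_space s" and s_of_real: "\<And>r v. s (of_real r) v = r *\<^sub>R v"
    and add: "\<And>u v. p (u + v) \<le> p u + p v"
    and scale: "\<And>c v. p (s c v) = norm c * p v"
  obtains F where "\<And>u v. F (u + v) = F u + F v" "\<And>c v. F (s c v) = c * F v"
    "\<And>v. norm (F v) \<le> p v" "norm (F a) = p a"
proof -
  interpret vector_space s by fact
  have "sublinear p"
  proof (rule sublinearI)
    show "p (r *\<^sub>R x) = r * p x" if "r \<ge> 0" for r x
      using scale[of "of_real r" x] that by (simp add: s_of_real)
  qed (rule add)
  then obtain g where g: "linear g" and gp: "\<And>x. g x \<le> p x" and ga: "g a = p a"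
    using hahn_banach_sublinear by blast
  have "\<exists>d. \<forall>c. g (s c v) = (c * d) \<bullet> 1" for v
  proof -
    have "linear (\<lambda>c. g (s c v))"
    proof (rule linearI)
      show "g (s (c + d) v) = g (s c v) + g (s d v)" for c d
        by (simp add: scale_left_distrib linear_add[OF g])
      show "g (s (r *\<^sub>R c) v) = r *\<^sub>R g (s c v)" for r c
        using linear_scale[OF g, of r "s c v"]
        by (simp add: scaleR_conv_of_real s_of_real flip: scale_scale)
    qed
    then show ?thesis using functional_eq_inner_one_mult by metis
  qed
  then obtain F where F: "\<And>v c. g (s c v) = (c * F v) \<bullet> 1" by metis
  have le: "norm (F v) \<le> p v" for v
  proof (cases "F v = 0")
    case True
    then show ?thesis using F[of 1 v] F[of "-1" v] gp[of v] by (simp add: F)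
  next
    case False
    \<comment> \<open>A scalar of norm 1 that rotates \<open>F v\<close> onto its norm, so that the
      bound on \<open>g\<close> at c v bounds \<open>norm (F v)\<close>.\<close>
    define c where "c = of_real (norm (F v)) * inverse (F v)"
    have "norm (F v) = (c * F v) \<bullet> 1"
      using False by (simp add: c_def scaleR_conv_of_real[symmetric] inner_one_one)
    also have "\<dots> \<le> p (s c v)" using gp[of "s c v"] by (simp add: F)
    also have "\<dots> = p v" using False by (simp add: scale c_def norm_mult norm_inverse)
    finally show ?thesis .
  qed
  show thesis
  proof
    show "F (u + v) = F u + F v" for u v
      by (rule inner_one_mult_eqD)
        (simp add: distrib_left inner_add_left scale_right_distrib linear_add[OF g] flip: F)
    show "F (s c v) = c * F v" for c v
      by (rule inner_one_mult_eqD) (simp flip: F mult.assoc)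
    show "norm (F v) \<le> p v" for v by (rule le)
    have "p a = F a \<bullet> 1" using F[of 1 a] ga by simp
    then show "norm (F a) = p a" using le[of a] inner_one_le_norm[of "F a"] by simp
  qed
qed

section \<open>Continuous duals and norming functionals\<close>

lemma dscale_apply [simp]: "blinfun_apply (dscale c f) x = c * f x"
  by (simp add: dscale_def)

lemma adjoint_op_apply [simp]: "blinfun_apply (adjoint_op T f) x = f (T x)"
  by (simp add: adjoint_op_def)

lemma dscale_of_real: "dscale (of_real r) f = r *\<^sub>R f"
  by (rule blinfun_eqI) (simp add: scaleR_conv_of_real blinfun.scaleR_left)

lemma vector_space_dscale:
  "vector_space (dscale :: 'k::{real_normed_field,euclidean_space} \<Rightarrow> ('v::real_normed_vector \<Rightarrow>\<^sub>L 'k) \<Rightarrow> _)"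
  by unfold_locales (auto intro!: blinfun_eqI simp: blinfun.add_left algebra_simps)

lemma norm_dscale:
  fixes c :: "'k::{real_normed_field,euclidean_space}" and f :: "'v::real_normed_vector \<Rightarrow>\<^sub>L 'k"
  shows "norm (dscale c f) = norm c * norm f"
proof -
  have le: "norm (dscale d h) \<le> norm d * norm h" for d :: 'k and h :: "'v \<Rightarrow>\<^sub>L 'k"
    by (rule norm_blinfun_bound)
      (auto simp: norm_mult mult.assoc intro!: mult_left_mono norm_blinfun)
  have "f = dscale (inverse c) (dscale c f)" if "c \<noteq> 0"
    using that by (intro blinfun_eqI) simp
  then have "norm c * norm f \<le> norm (dscale c f)"
    using le[of "inverse c" "dscale c f"] by (cases "c = 0") (auto simp: norm_divide field_simps)
  with le[of c f] show ?thesis by simp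
qed

lemma topdual_iff: "f \<in> topdual s \<longleftrightarrow> (\<forall>c v. blinfun_apply f (s c v) = c * f v)"
  by (simp add: topdual_def scalar_linear_def)

lemma topdual_add: "f \<in> topdual s \<Longrightarrow> g \<in> topdual s \<Longrightarrow> f + g \<in> topdual s"
  by (simp add: topdual_iff blinfun.add_left distrib_left)

lemma topdual_diff: "f \<in> topdual s \<Longrightarrow> g \<in> topdual s \<Longrightarrow> f - g \<in> topdual s"
  by (simp add: topdual_iff blinfun.diff_left right_diff_distrib)

lemma topdual_0: "0 \<in> topdual s"
  by (simp add: topdual_iff)

lemma topdual_dscale: "f \<in> topdual s \<Longrightarrow> dscale c f \<in> topdual s"
  by (simp add: topdual_iff)

lemma topdual_adjoint_op: "scalar_linear s t T \<Longrightarrow> f \<in> topdual t \<Longrightarrow> adjoint_op T f \<in> topdual s"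
  by (simp add: topdual_iff scalar_linear_def)

text \<open>Each condition equates two continuous functions of the functional. Closedness is what
  makes the summable sequences in \<open>topdual s\<close> a complete space.\<close>

lemma closed_topdual:
  "closed (topdual s :: ('v::real_normed_vector \<Rightarrow>\<^sub>L 'k::{real_normed_field,euclidean_space}) set)"
proof -
  have "topdual s = (\<Inter>c. \<Inter>v. {f. blinfun_apply f (s c v) = c * f v})"
    by (auto simp: topdual_iff)
  moreover have "closed {f. blinfun_apply f (s c v) = c * f v}" for c :: 'k and v :: 'v
    by (intro closed_Collect_eq continuous_intros)
  ultimately show ?thesis by (auto intro!: closed_INT)
qed

context scalar_banach
begin

text \<open>Hahn-Banach with the norm as the dominating seminorm. Only \<open>norm f \<le> 1\<close>
  is claimed, since the zero space has no functional of norm 1.\<close>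

lemma norming_functional:
  obtains f where "f \<in> topdual scale" "norm f \<le> 1" "norm (blinfun_apply f v) = norm v"
proof -
  obtain F where add: "\<And>u v. F (u + v) = F u + F v" and scl: "\<And>c v. F (scale c v) = c * F v"
    and le: "\<And>v. norm (F v) \<le> norm v" and v: "norm (F v) = norm v"
    using hahn_banach_seminorm[OF vector_space_axioms scale_of_real norm_triangle_ineq norm_scale]
    by blast
  have "bounded_linear F"
  proof (rule bounded_linear_intro)
    show "F (r *\<^sub>R x) = r *\<^sub>R F x" for r x
      using scl[of "of_real r" x] by (simp add: scale_of_real scaleR_conv_of_real)
    show "norm (F x) \<le> norm x * 1" for x by (simp add: le)
  qed (rule add)
  then have F: "blinfun_apply (Blinfun F) = F" by (rule bounded_linear_Blinfun_apply)
  show thesis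
  proof
    show "Blinfun F \<in> topdual scale" by (simp add: topdual_iff F scl)
    show "norm (Blinfun F) \<le> 1" by (rule norm_blinfun_bound) (simp_all add: F le)
    show "norm (blinfun_apply (Blinfun F) v) = norm v" by (simp add: F v)
  qed
qed

end

section \<open>Quotients and \<open>\<ell>\<^sup>1\<close>-sums of Banach spaces\<close>

context normed_space_on
begin

lemma N_geometric_le:
  assumes "\<And>k. w k \<in> V" and "\<And>k. N (w (Suc k) + scl (-1) (w k)) \<le> c * (1/2)^k" and "m \<ge> k"
  shows "N (w m + scl (-1) (w k)) \<le> 2 * c * (1/2)^k"
proof -
  obtain z where z: "z \<in> V" "\<And>v. v \<in> V \<Longrightarrow> z + v = v" "\<And>v. v \<in> V \<Longrightarrow> v + scl (-1) v = z"
    "\<And>v. v \<in> V \<Longrightarrow> N v = 0 \<longleftrightarrow> v = z"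
    using zero_ex by blast
  \<comment> \<open>The exact partial sum of the geometric series makes the induction close;
    dropping its second term gives the claim.\<close>
  have "N (w m + scl (-1) (w k)) \<le> 2 * c * (1/2)^k - 2 * c * (1/2)^m"
    using \<open>m \<ge> k\<close>
  proof (induction m rule: dec_induct)
    case base
    have "N z = 0" using z(4)[OF z(1)] by simp
    then show ?case using z(3) assms(1)[of k] by simp
  next
    case (step m)
    \<comment> \<open>The vector \<open>w m\<close> is inserted and cancelled through the neutral
      element \<open>z\<close> of the carrier, since the ambient type is only a semigroup.\<close>
    have "w (Suc m) + scl (-1) (w k) = (z + w (Suc m)) + scl (-1) (w k)"
      using z assms(1) by simp
    also have "z = w m + scl (-1) (w m)" using z assms(1) by simp
    finally have "w (Suc m) + scl (-1) (w k)
        = (w (Suc m) + scl (-1) (w m)) + (w m + scl (-1) (w k))"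
      by (simp add: ac_simps)
    then have "N (w (Suc m) + scl (-1) (w k))
        \<le> N (w (Suc m) + scl (-1) (w m)) + N (w m + scl (-1) (w k))"
      using N_triangle add_closed scl_closed assms(1) by metis
    with step.IH assms(2)[of m] show ?case by simp
  qed
  moreover have "c \<ge> 0"
    using assms(2)[of 0] N_nonneg[of "w (Suc 0) + scl (-1) (w 0)"] add_closed scl_closed assms(1)
    by simp
  then have "0 \<le> 2 * c * (1/2)^m" by simp
  ultimately show ?thesis by linarith
qed

end

lemma power_half_less:
  fixes c e :: real
  assumes "e > 0"
  obtains M where "\<And>k. k \<ge> M \<Longrightarrow> c * (1/2)^k < e"
proof -
  have "(\<lambda>k. c * (1/2::real)^k) \<longlonglongrightarrow> c * 0"
    by (intro tendsto_mult_left LIMSEQ_realpow_zero) auto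
  then have "\<forall>\<^sub>F k in sequentially. c * (1/2)^k < e"
    using order_tendstoD(2) assms by fastforce
  then show thesis using that by (auto simp: eventually_sequentially)
qed

text \<open>Geometric decay of the steps makes the sequence Cauchy. This serves both the
  completeness of quotients and the iteration that represents functionals on X.\<close>

lemma (in banach_space_on) geometric_convergent:
  assumes w: "\<And>k. w k \<in> V" and c: "\<And>k. N (w (Suc k) + scl (-1) (w k)) \<le> c * (1/2)^k"
  obtains v where "v \<in> V" "(\<lambda>n. N (w n + scl (-1) v)) \<longlonglongrightarrow> 0"
proof -
  have "\<exists>v\<in>V. (\<lambda>n. N (w n + scl (-1) v)) \<longlonglongrightarrow> 0"
  proof (rule complete[OF w])
    fix e :: real assume "e > 0"
    then obtain M where M: "\<And>k. k \<ge> M \<Longrightarrow> 2 * c * (1/2)^k < e"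
      using power_half_less by blast
    have "N (w m + scl (-1) (w n)) < e" if "m \<ge> M" "n \<ge> M" for m n
    proof (cases "m \<ge> n")
      case True
      then show ?thesis using N_geometric_le[OF w c, of n m] M[OF that(2)] by simp
    next
      case False
      obtain z where z: "z \<in> V" "\<And>v. v \<in> V \<Longrightarrow> z + v = v" "\<And>v. v \<in> V \<Longrightarrow> v + scl (-1) v = z"
        using zero_ex by blast
      have "scl (-1) (w n + scl (-1) (w m)) = w m + scl (-1) (w n)"
        using w by (simp add: scl_add_right scl_closed scl_scl scl_one add.commute)
      then have "N (w m + scl (-1) (w n)) = N (w n + scl (-1) (w m))"
        using N_scl[of "w n + scl (-1) (w m)" "-1"] w by (simp add: add_closed scl_closed)
      then show ?thesis using N_geometric_le[OF w c, of m n] M[OF that(1)] False by simp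
    qed
    then show "\<exists>M. \<forall>m\<ge>M. \<forall>n\<ge>M. N (w m + scl (-1) (w n)) < e" by blast
  qed
  then show thesis using that by blast
qed

section \<open>Quotient of a Banach space by a closed subspace\<close>

locale closed_subspace_on = banach_space_on V scl N
  for V :: "'v::ab_group_add set" and scl :: "'k::real_normed_field \<Rightarrow> 'v \<Rightarrow> 'v" and N +
  fixes P :: "'v set"
  assumes P_subset: "P \<subseteq> V"
    and P_zero: "0 \<in> P"
    and P_add: "u \<in> P \<Longrightarrow> v \<in> P \<Longrightarrow> u + v \<in> P"
    and P_scl: "v \<in> P \<Longrightarrow> scl c v \<in> P"
    and P_closed: "v \<in> V \<Longrightarrow> (\<And>e. e > 0 \<Longrightarrow> \<exists>p\<in>P. N (v + p) < e) \<Longrightarrow> v \<in> P"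
begin

text \<open>The neutral element z of the carrier satisfies z + z = z, so in a group it is the
  ambient 0, and \<open>scl (-1)\<close> is negation.\<close>

lemma zero_in: "0 \<in> V" and minus_one_scl: "v \<in> V \<Longrightarrow> scl (-1) v = - v" and N_zero: "N 0 = 0"
proof -
  obtain z where z: "z \<in> V" "\<And>v. v \<in> V \<Longrightarrow> z + v = v" "\<And>v. v \<in> V \<Longrightarrow> v + scl (-1) v = z"
    "\<And>v. v \<in> V \<Longrightarrow> N v = 0 \<longleftrightarrow> v = z"
    using zero_ex by blast
  have "z = 0" using z(2)[OF z(1)] by simp
  with z show "0 \<in> V" "N 0 = 0" "v \<in> V \<Longrightarrow> scl (-1) v = - v"
    by (auto simp: minus_unique[symmetric])
qed

lemma minus_in: "v \<in> V \<Longrightarrow> - v \<in> V"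
  using scl_closed[of v "-1"] by (simp add: minus_one_scl)

lemma diff_in: "u \<in> V \<Longrightarrow> v \<in> V \<Longrightarrow> u - v \<in> V"
  using add_closed[of u "- v"] minus_in by simp

lemma P_in: "p \<in> P \<Longrightarrow> p \<in> V"
  using P_subset by blast

lemma add_P_in: "v \<in> V \<Longrightarrow> p \<in> P \<Longrightarrow> v + p \<in> V"
  by (simp add: add_closed P_in)

lemma P_minus: "p \<in> P \<Longrightarrow> - p \<in> P"
  using P_scl[of p "-1"] minus_one_scl[of p] P_in by simp

lemma P_sum: "(\<And>i. i \<in> I \<Longrightarrow> f i \<in> P) \<Longrightarrow> sum f I \<in> P"
  by (induction I rule: infinite_finite_induct) (auto simp: P_zero P_add)

lemma N_bdd_below: "v \<in> V \<Longrightarrow> bdd_below (N ` (v +o P))"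
  by (rule bdd_belowI2[of _ 0]) (auto intro!: N_nonneg add_P_in simp: elt_set_plus_def)

lemma quot_norm_le: "v \<in> V \<Longrightarrow> p \<in> P \<Longrightarrow> quot_norm N (v +o P) \<le> N (v + p)"
  unfolding quot_norm_def by (intro cINF_lower N_bdd_below) auto

lemma quot_norm_le_N: "v \<in> V \<Longrightarrow> quot_norm N (v +o P) \<le> N v"
  using quot_norm_le[of v 0] P_zero by simp

lemma quot_norm_ge: "(\<And>p. p \<in> P \<Longrightarrow> c \<le> N (v + p)) \<Longrightarrow> c \<le> quot_norm N (v +o P)"
  unfolding quot_norm_def using P_zero
  by (intro cINF_greatest) (auto simp: elt_set_plus_def)

lemma quot_norm_less:
  assumes "quot_norm N (v +o P) < r"
  obtains p where "p \<in> P" "N (v + p) < r"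
proof -
  have "\<not> (\<forall>p\<in>P. r \<le> N (v + p))"
    using quot_norm_ge[of r v] assms by force
  then show thesis using that by (auto simp: not_le)
qed

lemma coset_eq_iff: "u +o P = v +o P \<longleftrightarrow> u - v \<in> P"
proof
  assume "u +o P = v +o P"
  then have "u \<in> v +o P" using P_zero by (force simp: elt_set_plus_def)
  then show "u - v \<in> P" by (auto simp: elt_set_plus_def)
next
  have *: "x +o P \<subseteq> y +o P" if "x - y \<in> P" for x y
  proof
    fix a assume "a \<in> x +o P"
    then obtain p where "p \<in> P" "a = x + p" by (auto simp: elt_set_plus_def)
    then have "a = y + ((x - y) + p)" "(x - y) + p \<in> P" using that P_add by auto
    then show "a \<in> y +o P" unfolding elt_set_plus_def by blast
  qed
  assume "u - v \<in> P"
  then show "u +o P = v +o P" using *[of u v] *[of v u] P_minus[of "u - v"] by auto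
qed

lemma P_plus_P: "P + P = P"
  using P_zero by (force simp: set_plus_def P_add)

lemma coset_add: "(u +o P) + (v +o P) = (u + v) +o P"
  by (simp add: set_plus_rearrange P_plus_P)

lemma coset_scale:
  assumes v: "v \<in> V"
  shows "quot_scale scl P c (v +o P) = scl c v +o P"
proof (rule set_eqI, rule iffI)
  fix a assume "a \<in> quot_scale scl P c (v +o P)"
  then obtain p p' where p: "p \<in> P" "p' \<in> P" and a: "a = scl c (v + p) + p'"
    by (auto simp: quot_scale_def set_plus_def elt_set_plus_def)
  then have "a = scl c v + (scl c p + p')" using v by (simp add: scl_add_right P_in add.assoc)
  with p show "a \<in> scl c v +o P" by (auto simp: elt_set_plus_def P_add P_scl)
next
  fix a assume "a \<in> scl c v +o P"
  then obtain p where "p \<in> P" "a = scl c (v + 0) + p" by (auto simp: elt_set_plus_def)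
  with P_zero show "a \<in> quot_scale scl P c (v +o P)"
    unfolding quot_scale_def set_plus_def elt_set_plus_def by blast
qed

lemma quot_spaceE:
  assumes "A \<in> quot_space V P"
  obtains v where "v \<in> V" "A = v +o P"
  using assms by (auto simp: quot_space_def)

lemma coset_in: "v \<in> V \<Longrightarrow> v +o P \<in> quot_space V P"
  by (simp add: quot_space_def)

lemma quot_norm_nonneg: "v \<in> V \<Longrightarrow> 0 \<le> quot_norm N (v +o P)"
  by (intro quot_norm_ge N_nonneg add_P_in)

text \<open>Here closedness of \<open>P\<close> enters: quotient norm 0 provides p in
  \<open>P\<close> with N(v + p) arbitrarily small.\<close>

lemma quot_norm_eq_0_iff:
  assumes v: "v \<in> V"
  shows "quot_norm N (v +o P) = 0 \<longleftrightarrow> v \<in> P"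
proof
  assume "quot_norm N (v +o P) = 0"
  then show "v \<in> P" using P_closed[OF v] quot_norm_less[of v] by metis
next
  assume "v \<in> P"
  then show "quot_norm N (v +o P) = 0"
    using quot_norm_le[OF v, of "- v"] quot_norm_nonneg[OF v] by (simp add: P_minus N_zero)
qed

lemma quot_norm_triangle:
  assumes u: "u \<in> V" and v: "v \<in> V"
  shows "quot_norm N ((u + v) +o P) \<le> quot_norm N (u +o P) + quot_norm N (v +o P)"
proof -
  have "quot_norm N ((u + v) +o P) - N (u + p) \<le> quot_norm N (v +o P)" if p: "p \<in> P" for p
  proof (rule quot_norm_ge)
    fix p' assume p': "p' \<in> P"
    have "quot_norm N ((u + v) +o P) \<le> N ((u + v) + (p + p'))"
      using u v p p' by (intro quot_norm_le add_closed P_add)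
    also have "(u + v) + (p + p') = (u + p) + (v + p')" by simp
    also have "N \<dots> \<le> N (u + p) + N (v + p')"
      using u v p p' by (intro N_triangle add_P_in)
    finally show "quot_norm N ((u + v) +o P) - N (u + p) \<le> N (v + p')" by simp
  qed
  then have "quot_norm N ((u + v) +o P) - quot_norm N (v +o P) \<le> quot_norm N (u +o P)"
    by (intro quot_norm_ge) (simp add: algebra_simps)
  then show ?thesis by simp
qed

lemma quot_norm_scale:
  assumes v: "v \<in> V"
  shows "quot_norm N (scl c v +o P) = norm c * quot_norm N (v +o P)"
proof (cases "c = 0")
  case True
  have "scl 0 v = 0" using scl_add_left[OF v, of 0 0] by simp
  with True show ?thesis using quot_norm_eq_0_iff[OF zero_in] P_zero by simp
next
  case False
  have le: "quot_norm N (scl d w +o P) \<le> norm d * quot_norm N (w +o P)"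
    if w: "w \<in> V" and d: "d \<noteq> 0" for d w
  proof -
    have "quot_norm N (scl d w +o P) / norm d \<le> quot_norm N (w +o P)"
    proof (rule quot_norm_ge)
      fix p assume p: "p \<in> P"
      have "quot_norm N (scl d w +o P) \<le> N (scl d w + scl d p)"
        using w p by (intro quot_norm_le scl_closed P_scl)
      also have "\<dots> = norm d * N (w + p)"
        using w p by (simp add: scl_add_right[symmetric] P_in N_scl add_closed)
      finally show "quot_norm N (scl d w +o P) / norm d \<le> N (w + p)"
        using d by (simp add: field_simps)
    qed
    then show ?thesis using d by (simp add: field_simps)
  qed
  have "quot_norm N (scl (inverse c) (scl c v) +o P)
      \<le> norm (inverse c) * quot_norm N (scl c v +o P)"
    using False v by (intro le scl_closed) auto
  then have "norm c * quot_norm N (v +o P) \<le> quot_norm N (scl c v +o P)"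
    using False v by (simp add: scl_scl scl_one norm_divide field_simps)
  with le[OF v False] show ?thesis by simp
qed

lemma normed_space_quotient: "normed_space_on (quot_space V P) (quot_scale scl P) (quot_norm N)"
proof
  show "\<exists>z\<in>quot_space V P. \<forall>A\<in>quot_space V P. z + A = A \<and> A + quot_scale scl P (- 1) A = z \<and>
      (quot_norm N A = 0 \<longleftrightarrow> A = z)"
  proof (intro bexI ballI)
    show "0 +o P \<in> quot_space V P" by (intro coset_in zero_in)
    fix A assume "A \<in> quot_space V P"
    then obtain v where v: "v \<in> V" "A = v +o P" by (rule quot_spaceE)
    then show "0 +o P + A = A \<and> A + quot_scale scl P (- 1) A = 0 +o P \<and>
        (quot_norm N A = 0 \<longleftrightarrow> A = 0 +o P)"
      using coset_add[of 0 v] coset_eq_iff[of v 0]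
      by (simp add: coset_add coset_scale minus_one_scl quot_norm_eq_0_iff)
  qed
qed (auto elim!: quot_spaceE simp: coset_add coset_scale add_closed scl_closed coset_in
      scl_add_right scl_add_left scl_scl scl_one quot_norm_nonneg quot_norm_scale quot_norm_triangle)

text \<open>Along a fast subsequence of a Cauchy sequence of cosets, representatives are corrected
  by elements of \<open>P\<close> until their steps decay geometrically in \<open>V\<close>. They
  then converge there, and the Cauchy property carries the limit over to the whole sequence of
  cosets.\<close>

theorem banach_space_quotient: "banach_space_on (quot_space V P) (quot_scale scl P) (quot_norm N)"
proof -
  interpret Q: normed_space_on "quot_space V P" "quot_scale scl P" "quot_norm N"
    by (rule normed_space_quotient)
  let ?q = "\<lambda>v. quot_norm N (v +o P)"
  show ?thesis
  proof
    fix u :: "nat \<Rightarrow> 'v set"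
    assume u: "\<And>n. u n \<in> quot_space V P"
      and cauchy: "\<And>e. e > 0 \<Longrightarrow>
        \<exists>M. \<forall>m\<ge>M. \<forall>n\<ge>M. quot_norm N (u m + quot_scale scl P (- 1) (u n)) < e"
    have "\<forall>n. \<exists>v. v \<in> V \<and> u n = v +o P" using u quot_spaceE by metis
    then obtain v where v: "\<And>n. v n \<in> V" and uv: "\<And>n. u n = v n +o P" by metis
    have diff: "quot_norm N (u m + quot_scale scl P (- 1) (w +o P)) = ?q (v m - w)"
      if "w \<in> V" for m w
      using that v by (simp add: uv coset_scale coset_add minus_one_scl)
    have diff_v: "quot_norm N (u m + quot_scale scl P (- 1) (u n)) = ?q (v m - v n)" for m n
      using diff[OF v, of m n] by (simp only: uv[of n])
    have "\<exists>M. \<forall>m\<ge>M. \<forall>n\<ge>M. ?q (v m - v n) < (1/2)^k" for k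
      using cauchy[of "(1/2)^k"] by (simp add: diff_v)
    then obtain M :: "nat \<Rightarrow> nat" where M: "\<And>k m n. m \<ge> M k \<Longrightarrow> n \<ge> M k \<Longrightarrow> ?q (v m - v n) < (1/2)^k"
      by metis
    \<comment> \<open>A sum of indices replaces a maximum: \<open>r k\<close> and
      \<open>r (Suc k)\<close> are both at least \<open>M k\<close>, so the chosen consecutive
      cosets are less than (1/2)^k apart.\<close>
    define r where "r k = sum M {..k}" for k
    have r: "r k \<ge> M k" "r (Suc k) \<ge> M k" for k
      by (auto simp: r_def member_le_sum trans_le_add1)
    have "\<exists>p\<in>P. N (v (r (Suc k)) - v (r k) + p) < (1/2)^k" for k
      using quot_norm_less[OF M[OF r(2) r(1)]] by blast
    then obtain p where p: "\<And>k. p k \<in> P"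
      and Np: "\<And>k. N (v (r (Suc k)) - v (r k) + p k) < (1/2)^k" by metis
    \<comment> \<open>The corrections accumulate: \<open>w k\<close> still represents
      \<open>u (r k)\<close>, and its next increment is the difference of representatives corrected
      by \<open>p k\<close>.\<close>
    define w where "w k = v (r k) + sum p {..<k}" for k
    have w: "w k \<in> V" for k unfolding w_def by (intro add_closed v P_in P_sum p)
    obtain x where x: "x \<in> V" and lim: "(\<lambda>n. N (w n + scl (-1) x)) \<longlonglongrightarrow> 0"
    proof (rule geometric_convergent)
      show "w k \<in> V" for k by (rule w)
      have "w (Suc k) + scl (-1) (w k) = v (r (Suc k)) - v (r k) + p k" for k
        unfolding minus_one_scl[OF w] by (simp add: w_def)
      then show "N (w (Suc k) + scl (-1) (w k)) \<le> 1 * (1/2)^k" for k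
        using Np[of k] by simp
    qed
    \<comment> \<open>Since \<open>w k\<close> and \<open>v (r k)\<close> have the same coset, the
      quotient distance from \<open>v (r k)\<close> to \<open>x\<close> is at most N(w k -
      x).\<close>
    have bound: "?q (v n - x) \<le> (1/2)^k + N (w k + scl (-1) x)" if n: "n \<ge> r k" for n k
    proof -
      have "?q (v n - x) \<le> ?q (v n - v (r k)) + ?q (v (r k) - x)"
        using quot_norm_triangle[of "v n - v (r k)" "v (r k) - x"] by (simp add: diff_in v x)
      moreover have "?q (v n - v (r k)) \<le> (1/2)^k"
        using M[of k n "r k"] r(1)[of k] n by simp
      moreover have "?q (v (r k) - x) \<le> N (w k + scl (-1) x)"
      proof -
        have "w k + scl (-1) x = (v (r k) - x) + sum p {..<k}"
          by (simp add: w_def minus_one_scl[OF x])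
        then show ?thesis using quot_norm_le[of "v (r k) - x" "sum p {..<k}"]
          by (simp add: diff_in v x P_sum p)
      qed
      ultimately show ?thesis by linarith
    qed
    have "(\<lambda>n. ?q (v n - x)) \<longlonglongrightarrow> 0"
    proof (rule LIMSEQ_I)
      fix e :: real assume "e > 0"
      have "(\<lambda>k. (1/2)^k + N (w k + scl (-1) x)) \<longlonglongrightarrow> 0 + 0"
        by (intro tendsto_add lim LIMSEQ_realpow_zero) auto
      then have "\<forall>\<^sub>F k in sequentially. (1/2)^k + N (w k + scl (-1) x) < e"
        using \<open>e > 0\<close> order_tendstoD(2)[of _ "0 + 0" sequentially e] by simp
      then obtain k where "(1/2)^k + N (w k + scl (-1) x) < e"
        by (auto simp: eventually_sequentially)
      then have "norm (?q (v n - x) - 0) < e" if "n \<ge> r k" for n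
        using bound[OF that] quot_norm_nonneg[OF diff_in[OF v x]] by (simp add: abs_of_nonneg)
      then show "\<exists>no. \<forall>n\<ge>no. norm (?q (v n - x) - 0) < e" by blast
    qed
    then show "\<exists>A\<in>quot_space V P. (\<lambda>n. quot_norm N (u n + quot_scale scl P (- 1) A)) \<longlonglongrightarrow> 0"
      using x by (intro bexI[of _ "x +o P"]) (simp_all add: diff coset_in)
  qed
qed

end

section \<open>Completeness of the space of summable sequences\<close>

theorem banach_space_ell1:
  fixes A :: "'v::banach set" and scl :: "'k::real_normed_field \<Rightarrow> 'v \<Rightarrow> 'v"
  assumes "closed A" and "vector_space scl" and zero: "0 \<in> A"
    and add: "\<And>u v. u \<in> A \<Longrightarrow> v \<in> A \<Longrightarrow> u + v \<in> A" and scl: "\<And>c v. v \<in> A \<Longrightarrow> scl c v \<in> A"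
    and norm_scl: "\<And>c v. norm (scl c v) = norm c * norm v"
  shows "banach_space_on (ell1 A) (ell1_scale scl) ell1_norm"
proof -
  interpret vector_space scl by fact
  have summable_add: "summable (\<lambda>n. norm (u n + v n))"
    if "summable (\<lambda>n. norm (u n))" "summable (\<lambda>n. norm (v n))" for u v :: "nat \<Rightarrow> 'v"
    using summable_add[OF that] by (rule summable_comparison_test_ev[rotated])
      (simp add: norm_triangle_ineq)
  have minus: "u + ell1_scale scl (- 1) v = u - v" for u v
    by (simp add: ell1_scale_def fun_eq_iff scale_minus_left)
  show ?thesis
  proof
    show "\<exists>z\<in>ell1 A. \<forall>v\<in>ell1 A. z + v = v \<and> v + ell1_scale scl (- 1) v = z \<and>
        (ell1_norm v = 0 \<longleftrightarrow> v = z)"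
    proof (intro bexI ballI)
      show "0 \<in> ell1 A" by (simp add: ell1_def zero)
      show "0 + v = v \<and> v + ell1_scale scl (- 1) v = 0 \<and> (ell1_norm v = 0 \<longleftrightarrow> v = 0)"
        if "v \<in> ell1 A" for v
        using that suminf_eq_zero_iff[of "\<lambda>n. norm (v n)"]
        by (simp add: minus) (auto simp: ell1_def ell1_norm_def fun_eq_iff)
    qed
    fix u v :: "nat \<Rightarrow> 'v" and c d :: 'k
    assume v: "v \<in> ell1 A"
    then show "ell1_scale scl c v \<in> ell1 A"
      by (auto simp: ell1_def ell1_scale_def scl norm_scl intro: summable_mult)
    show "ell1_norm (ell1_scale scl c v) = norm c * ell1_norm v"
      using v by (simp add: ell1_def ell1_norm_def ell1_scale_def norm_scl suminf_mult)
    show "ell1_scale scl (c + d) v = ell1_scale scl c v + ell1_scale scl d v"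
      by (simp add: ell1_scale_def fun_eq_iff scale_left_distrib)
    show "ell1_scale scl c (ell1_scale scl d v) = ell1_scale scl (c * d) v"
      "ell1_scale scl 1 v = v"
      by (simp_all add: ell1_scale_def)
    show "0 \<le> ell1_norm v"
      using v by (auto simp: ell1_norm_def ell1_def intro: suminf_nonneg)
    assume u: "u \<in> ell1 A"
    show "u + v \<in> ell1 A" using u v by (simp add: ell1_def add summable_add)
    show "ell1_scale scl c (u + v) = ell1_scale scl c u + ell1_scale scl c v"
      by (simp add: ell1_scale_def fun_eq_iff scale_right_distrib)
    show "ell1_norm (u + v) \<le> ell1_norm u + ell1_norm v"
      using u v unfolding ell1_norm_def ell1_def
      by (auto simp: suminf_add intro!: suminf_le norm_triangle_ineq summable_add Series.summable_add)
  next
    fix u :: "nat \<Rightarrow> nat \<Rightarrow> 'v"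
    assume u: "\<And>n. u n \<in> ell1 A"
      and cauchy: "\<And>e. e > 0 \<Longrightarrow>
        \<exists>M. \<forall>m\<ge>M. \<forall>n\<ge>M. ell1_norm (u m + ell1_scale scl (- 1) (u n)) < e"
    have summable: "summable (\<lambda>i. norm (u m i - u n i))" for m n
      using summable_add[of "u m" "\<lambda>i. - u n i"] u by (simp add: ell1_def)
    have part: "(\<Sum>i<k. norm (u m i - u n i)) \<le> ell1_norm (u m - u n)" for k m n
      unfolding ell1_norm_def fun_diff_def
      by (intro sum_le_suminf summable) auto
    have "Cauchy (\<lambda>n. u n i)" for i
    proof (rule CauchyI)
      fix e :: real assume "e > 0"
      then obtain M where M: "\<And>m n. m \<ge> M \<Longrightarrow> n \<ge> M \<Longrightarrow> ell1_norm (u m - u n) < e"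
        using cauchy minus by metis
      have "norm (u m i - u n i) < e" if "m \<ge> M" "n \<ge> M" for m n
      proof -
        have "norm (u m i - u n i) \<le> (\<Sum>j<Suc i. norm (u m j - u n j))"
          by (intro member_le_sum) auto
        then show ?thesis using part[of m n "Suc i"] M[OF that] by linarith
      qed
      then show "\<exists>M. \<forall>m\<ge>M. \<forall>n\<ge>M. norm (u m i - u n i) < e" by blast
    qed
    then have "\<forall>i. \<exists>l. (\<lambda>n. u n i) \<longlonglongrightarrow> l" using Cauchy_convergent convergent_def by blast
    then obtain v where v: "\<And>i. (\<lambda>n. u n i) \<longlonglongrightarrow> v i" by metis
    \<comment> \<open>For a fixed number k of terms, n tends to infinity first; the bound
      \<open>e\<close> does not depend on k, so it yields both summability and the norm
      estimate.\<close>
    have bound: "summable (\<lambda>i. norm (u m i - v i)) \<and> ell1_norm (u m - v) \<le> e"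
      if M: "\<And>n. n \<ge> M \<Longrightarrow> ell1_norm (u m - u n) < e" for m M e
    proof -
      have le: "(\<Sum>i<k. norm (u m i - v i)) \<le> e" for k
      proof (rule tendsto_upperbound)
        show "(\<lambda>n. \<Sum>i<k. norm (u m i - u n i)) \<longlonglongrightarrow> (\<Sum>i<k. norm (u m i - v i))"
          by (intro tendsto_intros v)
        have "(\<Sum>i<k. norm (u m i - u n i)) \<le> e" if "n \<ge> M" for n
          using part[where k = k and m = m and n = n] M[OF that] by linarith
        then show "\<forall>\<^sub>F n in sequentially. (\<Sum>i<k. norm (u m i - u n i)) \<le> e"
          by (auto simp: eventually_sequentially)
      qed simp
      have "summable (\<lambda>i. norm (u m i - v i))"
        using le by (intro summableI_nonneg_bounded) auto
      then show ?thesis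
        using le by (auto simp: ell1_norm_def fun_diff_def intro: suminf_le_const)
    qed
    have "v i \<in> A" for i
      by (rule closed_sequentially[OF \<open>closed A\<close> _ v[of i]]) (use u in \<open>simp add: ell1_def\<close>)
    moreover have "summable (\<lambda>i. norm (v i))"
    proof -
      obtain M where "\<And>m n. m \<ge> M \<Longrightarrow> n \<ge> M \<Longrightarrow> ell1_norm (u m - u n) < 1"
        using cauchy[of 1] by (auto simp: minus)
      then have "summable (\<lambda>i. norm (u M i - v i))" using bound by blast
      \<comment> \<open>Summability is transferred through v = u M - (u M - v).\<close>
      then show ?thesis
        using summable_add[of "u M" "\<lambda>i. - (u M i - v i)"] u by (simp add: ell1_def norm_minus_commute)
    qed
    ultimately have "v \<in> ell1 A" by (simp add: ell1_def)
    moreover have "(\<lambda>m. ell1_norm (u m - v)) \<longlonglongrightarrow> 0"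
    proof (rule LIMSEQ_I)
      fix e :: real assume "e > 0"
      then obtain M where M: "\<And>m n. m \<ge> M \<Longrightarrow> n \<ge> M \<Longrightarrow> ell1_norm (u m - u n) < e / 2"
        using cauchy[of "e / 2"] minus by (metis half_gt_zero)
      have "norm (ell1_norm (u m - v) - 0) < e" if "m \<ge> M" for m
      proof -
        have b: "summable (\<lambda>i. norm (u m i - v i)) \<and> ell1_norm (u m - v) \<le> e / 2"
          using bound M that by blast
        then have "0 \<le> ell1_norm (u m - v)" by (auto simp: ell1_norm_def intro: suminf_nonneg)
        with b \<open>e > 0\<close> show ?thesis by simp
      qed
      then show "\<exists>no. \<forall>m\<ge>no. norm (ell1_norm (u m - v) - 0) < e" by blast
    qed
    ultimately show "\<exists>v\<in>ell1 A. (\<lambda>n. ell1_norm (u n + ell1_scale scl (- 1) v)) \<longlonglongrightarrow> 0"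
      by (auto simp: minus)
  qed
qed

section \<open>The predual\<close>

definition single :: "nat \<Rightarrow> 'v::zero \<Rightarrow> nat \<Rightarrow> 'v"
  where "single n f = (\<lambda>m. if m = n then f else 0)"

text \<open>An arbitrary family \<open>h\<close> that vanishes at 0 covers both norms and
  evaluations at the points \<open>L m x\<close>.\<close>

lemma single_sums: "(\<And>m. h m 0 = 0) \<Longrightarrow> (\<lambda>m. h m (single n f m)) sums h n f"
  unfolding single_def by (rule sums_cong[THEN iffD1, OF _ sums_single[of n "\<lambda>m. h m f"]]) auto

lemma ell1_norm_single: "ell1_norm (single n f) = norm f"
  unfolding ell1_norm_def using single_sums[of "\<lambda>_. norm" n f] by (simp add: sums_iff)

lemma single_in_ell1: "f \<in> A \<Longrightarrow> 0 \<in> A \<Longrightarrow> single n f \<in> ell1 A"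
  using single_sums[of "\<lambda>_. norm" n f] by (auto simp: ell1_def sums_iff) (simp add: single_def)

text \<open>The error is the tail of the norm series. Hence bounded functionals on the sequence
  space are determined by their values on sequences with one nonzero entry.\<close>

lemma ell1_norm_truncate_tendsto:
  assumes "y \<in> ell1 A"
  shows "(\<lambda>k. ell1_norm (y - (\<Sum>n<k. single n (y n)))) \<longlonglongrightarrow> 0"
proof -
  have y: "summable (\<lambda>n. norm (y n))" using assms by (simp add: ell1_def)
  have trunc: "(\<Sum>n<k. single n (y n)) m = (if m < k then y m else 0)" for k m
    by (induction k) (auto simp: single_def less_Suc_eq)
  have "ell1_norm (y - (\<Sum>n<k. single n (y n))) = ell1_norm y - (\<Sum>n<k. norm (y n))" for k
  proof -
    have "(\<lambda>m. norm (y m) - (if m \<in> {..<k} then norm (y m) else 0))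
        sums (ell1_norm y - (\<Sum>n<k. norm (y n)))"
      unfolding ell1_norm_def by (intro sums_diff summable_sums y sums_If_finite_set) simp
    moreover have "norm (y m) - (if m \<in> {..<k} then norm (y m) else 0)
        = norm ((y - (\<Sum>n<k. single n (y n))) m)" for m
      by (simp add: fun_diff_def trunc)
    ultimately show ?thesis unfolding ell1_norm_def by (simp add: sums_iff)
  qed
  moreover have "(\<lambda>k. ell1_norm y - (\<Sum>n<k. norm (y n))) \<longlonglongrightarrow> ell1_norm y - ell1_norm y"
    unfolding ell1_norm_def by (intro tendsto_diff tendsto_const summable_LIMSEQ y)
  ultimately show ?thesis by simp
qed

section \<open>The pairing of E with summable sequences of functionals\<close>

locale predual_setting = X: scalar_banach sX + Y: scalar_banach sY
  for sX :: "'k::{real_normed_field,euclidean_space} \<Rightarrow> 'x::banach \<Rightarrow> 'x"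
    and sY :: "'k \<Rightarrow> 'y::banach \<Rightarrow> 'y" +
  fixes L :: "nat \<Rightarrow> 'x \<Rightarrow>\<^sub>L 'y" and C :: real
  assumes X_reflexive: "reflexive_space sX"
    and L: "\<And>n. scalar_linear sX sY (L n)"
    and E_normed: "normed_space_on (E_space L) sX (E_norm L)"
    and C_pos: "C > 0"
    and E_continuous: "\<And>x. x \<in> E_space L \<Longrightarrow> norm x \<le> C * E_norm L x"
begin

abbreviation D :: "(nat \<Rightarrow> 'y \<Rightarrow>\<^sub>L 'k) set"
  where "D \<equiv> ell1 (topdual sY)"

definition pairing :: "(nat \<Rightarrow> 'y \<Rightarrow>\<^sub>L 'k) \<Rightarrow> 'x \<Rightarrow> 'k"
  where "pairing y x = (\<Sum>n. y n (L n x))"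

sublocale E: normed_space_on "E_space L" sX "E_norm L"
  by (rule E_normed)

sublocale D: banach_space_on D "ell1_scale dscale" ell1_norm
  by (intro banach_space_ell1 closed_topdual vector_space_dscale topdual_0 topdual_add
      topdual_dscale norm_dscale)

lemma norm_le_E_norm: "x \<in> E_space L \<Longrightarrow> norm (L n x) \<le> E_norm L x"
  unfolding E_space_def E_norm_def by (rule cSUP_upper) auto

lemma E_spaceI: "(\<And>n. norm (L n x) \<le> B) \<Longrightarrow> x \<in> E_space L"
  unfolding E_space_def by (auto intro: bdd_aboveI2[of _ _ B])

lemma E_norm_le: "(\<And>n. norm (L n x) \<le> B) \<Longrightarrow> E_norm L x \<le> B"
  unfolding E_norm_def by (intro cSUP_least) auto

lemma norm_apply_le:
  assumes "y \<in> D" "x \<in> E_space L"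
  shows "norm (y n (L n x)) \<le> norm (y n) * E_norm L x"
  using norm_blinfun[of "y n" "L n x"] mult_left_mono[OF norm_le_E_norm[OF assms(2), of n], of "norm (y n)"]
  by simp

lemma summable_pairing:
  assumes y: "y \<in> D" and x: "x \<in> E_space L"
  shows "summable (\<lambda>n. norm (y n (L n x)))"
proof (rule summable_comparison_test')
  show "summable (\<lambda>n. norm (y n) * E_norm L x)"
    using y by (auto simp: ell1_def intro: summable_mult2)
  show "norm (norm (y n (L n x))) \<le> norm (y n) * E_norm L x" for n
    using norm_apply_le[OF y x] by simp
qed

lemma pairing_sums: "y \<in> D \<Longrightarrow> x \<in> E_space L \<Longrightarrow> (\<lambda>n. y n (L n x)) sums pairing y x"
  unfolding pairing_def by (rule summable_sums[OF summable_norm_cancel[OF summable_pairing]])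

lemma norm_pairing_le:
  assumes y: "y \<in> D" and x: "x \<in> E_space L"
  shows "norm (pairing y x) \<le> E_norm L x * ell1_norm y"
proof -
  have s: "summable (\<lambda>n. norm (y n))" using y by (simp add: ell1_def)
  have "norm (pairing y x) \<le> (\<Sum>n. norm (y n (L n x)))"
    unfolding pairing_def by (intro summable_norm summable_pairing y x)
  also have "\<dots> \<le> (\<Sum>n. norm (y n) * E_norm L x)"
    using norm_apply_le[OF y x] by (intro suminf_le summable_pairing y x summable_mult2 s)
  also have "\<dots> = ell1_norm y * E_norm L x"
    unfolding ell1_norm_def by (rule suminf_mult2[OF s, symmetric])
  finally show ?thesis by (simp add: mult.commute)
qed

lemma pairing_add:
  assumes "y \<in> D" "z \<in> D" "x \<in> E_space L"
  shows "pairing (y + z) x = pairing y x + pairing z x"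
  using sums_add[OF pairing_sums[OF assms(1,3)] pairing_sums[OF assms(2,3)]]
  unfolding pairing_def by (simp add: sums_iff blinfun.add_left)

lemma pairing_scale:
  assumes "y \<in> D" "x \<in> E_space L"
  shows "pairing (ell1_scale dscale c y) x = c * pairing y x"
  using sums_mult[OF pairing_sums[OF assms], of c]
  unfolding pairing_def by (simp add: sums_iff ell1_scale_def)

lemma pairing_add_right:
  assumes "y \<in> D" "x \<in> E_space L" "x' \<in> E_space L"
  shows "pairing y (x + x') = pairing y x + pairing y x'"
  using sums_add[OF pairing_sums[OF assms(1,2)] pairing_sums[OF assms(1,3)]]
  unfolding pairing_def by (simp add: sums_iff blinfun.add_right)

lemma pairing_scale_right:
  assumes "y \<in> D" "x \<in> E_space L"
  shows "pairing y (sX c x) = c * pairing y x"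
proof -
  have "y n (L n (sX c x)) = c * y n (L n x)" for n
    using L[of n] assms(1) by (simp add: scalar_linear_def ell1_def topdual_iff)
  then show ?thesis
    using sums_mult[OF pairing_sums[OF assms], of c] unfolding pairing_def by (simp add: sums_iff)
qed

lemma single_in: "f \<in> topdual sY \<Longrightarrow> single n f \<in> D"
  by (intro single_in_ell1 topdual_0)

lemma pairing_single: "pairing (single n f) x = f (L n x)"
  unfolding pairing_def using single_sums[of "\<lambda>m g. blinfun_apply g (L m x)" n f]
  by (simp add: sums_iff)

lemma P_space_iff: "y \<in> P_space sY L \<longleftrightarrow> y \<in> D \<and> (\<forall>x\<in>E_space L. pairing y x = 0)"
  unfolding P_space_def using pairing_sums by (auto simp: sums_iff)

sublocale Q: closed_subspace_on D "ell1_scale dscale" ell1_norm "P_space sY L"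
proof
  show "P_space sY L \<subseteq> D" by (auto simp: P_space_iff)
  show "0 \<in> P_space sY L" by (auto simp: P_space_iff pairing_def ell1_def topdual_0)
  show "u + v \<in> P_space sY L" if "u \<in> P_space sY L" "v \<in> P_space sY L" for u v
    using that by (auto simp: P_space_iff pairing_add D.add_closed)
  show "ell1_scale dscale c v \<in> P_space sY L" if "v \<in> P_space sY L" for c v
    using that by (auto simp: P_space_iff pairing_scale D.scl_closed)
  show "v \<in> P_space sY L"
    if v: "v \<in> D" and small: "\<And>e. e > 0 \<Longrightarrow> \<exists>p\<in>P_space sY L. ell1_norm (v + p) < e" for v
    unfolding P_space_iff
  proof (intro conjI ballI v)
    fix x assume x: "x \<in> E_space L"
    have "norm (pairing v x) \<le> 0 + e" if "e > 0" for e
    proof -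
      have E: "E_norm L x \<ge> 0" using x by (rule E.N_nonneg)
      \<comment> \<open>Adding \<open>p\<close> does not change the pairing with \<open>x\<close>.
        The \<open>+ 1\<close> keeps the divisor positive when \<open>E_norm L x\<close> is
        0.\<close>
      obtain p where p: "p \<in> P_space sY L" "ell1_norm (v + p) < e / (E_norm L x + 1)"
        using small[of "e / (E_norm L x + 1)"] E \<open>e > 0\<close> by (auto simp: divide_pos_pos)
      then have "pairing v x = pairing (v + p) x" using v x by (simp add: P_space_iff pairing_add)
      then have "norm (pairing v x) \<le> E_norm L x * ell1_norm (v + p)"
        using p v x by (simp add: norm_pairing_le D.add_closed P_space_iff)
      also have "\<dots> \<le> (E_norm L x + 1) * ell1_norm (v + p)"
        using D.N_nonneg[of "v + p"] p v by (intro mult_right_mono) (auto simp: D.add_closed P_space_iff)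
      also have "\<dots> \<le> e" using p(2) E by (simp add: field_simps)
      finally show ?thesis by simp
    qed
    then have "norm (pairing v x) \<le> 0" by (rule field_le_epsilon)
    then show "pairing v x = 0" by simp
  qed
qed

lemma pairing_diff:
  assumes "y \<in> D" "z \<in> D" "x \<in> E_space L"
  shows "pairing (y - z) x = pairing y x - pairing z x"
  using pairing_add[of "y - z" z x] assms by (simp add: Q.diff_in)

text \<open>A norming functional in the dual of Y turns bounds on functionals into a bound on the
  vector. This suits points obtained from reflexivity, which are known only through the functionals
  applied to them.\<close>

lemma norm_L_le_dual:
  assumes "\<And>f. f \<in> topdual sY \<Longrightarrow> norm (blinfun_apply f (L n x)) \<le> B * norm f" and "B \<ge> 0"
  shows "norm (L n x) \<le> B"
proof -
  obtain f where f: "f \<in> topdual sY" "norm f \<le> 1" "norm (blinfun_apply f (L n x)) = norm (L n x)"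
    by (rule Y.norming_functional)
  then have "norm (L n x) \<le> B * norm f" using assms(1)[of f] by simp
  also have "\<dots> \<le> B" using mult_left_mono[OF f(2) assms(2)] by simp
  finally show ?thesis .
qed

section \<open>Representing functionals on X by summable sequences\<close>

lemma approx_representation:
  assumes f: "f \<in> topdual sX"
  obtains y h where "y \<in> D" "h \<in> topdual sX" "\<And>x. x \<in> E_space L \<Longrightarrow> pairing y x = blinfun_apply h x"
    "ell1_norm y \<le> 2 * C * norm f" "norm (f - h) \<le> norm f / 2"
proof -
  define R where
    "R = {(y, h). y \<in> D \<and> h \<in> topdual sX \<and> (\<forall>x\<in>E_space L. pairing y x = blinfun_apply h x)}"
  have R0: "(0, 0) \<in> R"
    by (simp add: R_def Q.zero_in topdual_0 pairing_def)
  have R_add: "(y + z, g + h) \<in> R" if "(y, g) \<in> R" "(z, h) \<in> R" for y z g h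
    using that by (simp add: R_def D.add_closed topdual_add pairing_add blinfun.add_left)
  have R_scale: "(ell1_scale dscale c y, dscale c h) \<in> R" if "(y, h) \<in> R" for c y h
    using that by (simp add: R_def D.scl_closed topdual_dscale pairing_scale)
  have R_single: "(single n k, adjoint_op (L n) k) \<in> R" if "k \<in> topdual sY" for n k
    using that topdual_adjoint_op[OF L that] by (simp add: R_def single_in pairing_single)
  define S where "S g = (\<lambda>(y, h). ell1_norm y + 4 * C * norm (g - h)) ` R" for g
  define p where "p g = Inf (S g)" for g
  have "bdd_below (S g)" for g
    using C_pos D.N_nonneg by (intro bdd_belowI[of _ 0]) (auto simp: S_def R_def)
  then have le: "p g \<le> ell1_norm y + 4 * C * norm (g - h)" if "(y, h) \<in> R" for g y h
    unfolding p_def using that by (intro cInf_lower) (auto simp: S_def)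
  have ge: "c \<le> p g" if "\<And>y h. (y, h) \<in> R \<Longrightarrow> c \<le> ell1_norm y + 4 * C * norm (g - h)" for c g
    unfolding p_def using that R0 by (intro cInf_greatest) (auto simp: S_def)
  have add: "p (g + g') \<le> p g + p g'" for g g'
  proof -
    have "p (g + g') - (ell1_norm y + 4 * C * norm (g - h)) \<le> p g'" if 1: "(y, h) \<in> R" for y h
    proof (rule ge)
      fix z k assume 2: "(z, k) \<in> R"
      have "norm (g + g' - (h + k)) \<le> norm (g - h) + norm (g' - k)"
        by (metis add_diff_add norm_triangle_ineq)
      then have "4 * C * norm (g + g' - (h + k)) \<le> 4 * C * (norm (g - h) + norm (g' - k))"
        using C_pos by simp
      moreover have "ell1_norm (y + z) \<le> ell1_norm y + ell1_norm z"
        using 1 2 by (intro D.N_triangle) (auto simp: R_def)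
      ultimately show "p (g + g') - (ell1_norm y + 4 * C * norm (g - h))
          \<le> ell1_norm z + 4 * C * norm (g' - k)"
        using le[OF R_add[OF 1 2], of "g + g'"] by (simp add: algebra_simps)
    qed
    then have "p (g + g') - p g' \<le> p g" by (intro ge) (simp add: algebra_simps)
    then show ?thesis by simp
  qed
  have scale_le: "p (dscale c g) \<le> norm c * p g" if c: "c \<noteq> 0" for c g
  proof -
    have "p (dscale c g) / norm c \<le> p g"
    proof (rule ge)
      fix y h assume yh: "(y, h) \<in> R"
      have "dscale c g - dscale c h = dscale c (g - h)"
        by (rule blinfun_eqI) (simp add: blinfun.diff_left right_diff_distrib)
      then have "p (dscale c g) \<le> norm c * ell1_norm y + 4 * C * (norm c * norm (g - h))"
        using le[OF R_scale[OF yh, of c], of "dscale c g"] yh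
        by (simp add: R_def D.N_scl norm_dscale)
      then show "p (dscale c g) / norm c \<le> ell1_norm y + 4 * C * norm (g - h)"
        using c by (simp add: field_simps)
    qed
    then show ?thesis using c by (simp add: field_simps)
  qed
  have p0: "p 0 = 0"
  proof (rule antisym)
    show "p 0 \<le> 0" using le[OF R0, of 0] by (simp add: Q.N_zero)
    show "0 \<le> p 0" using C_pos D.N_nonneg by (intro ge) (auto simp: R_def)
  qed
  have scale: "p (dscale c g) = norm c * p g" for c g
  proof (cases "c = 0")
    case True
    moreover have "dscale 0 g = 0" by (rule blinfun_eqI) simp
    ultimately show ?thesis by (simp add: p0)
  next
    case False
    have "dscale (inverse c) (dscale c g) = g" using False by (intro blinfun_eqI) simp
    then have "p g \<le> norm (inverse c) * p (dscale c g)"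
      using scale_le[of "inverse c" "dscale c g"] False by simp
    then have "norm c * p g \<le> p (dscale c g)" using False by (simp add: norm_divide field_simps)
    with scale_le[OF False, of g] show ?thesis by simp
  qed
  \<comment> \<open>Since \<open>F\<close> attains \<open>p\<close> at \<open>f\<close>, bounding
    p(f) amounts to bounding F(f), which reflexivity turns into an evaluation of
    \<open>f\<close>.\<close>
  obtain F where F_add: "\<And>u v. F (u + v) = F u + F v" and F_scl: "\<And>c v. F (dscale c v) = c * F v"
    and F_le: "\<And>v. norm (F v) \<le> p v" and F_f: "norm (F f) = p f"
    using hahn_banach_seminorm[OF vector_space_dscale dscale_of_real add scale] by blast
  have "p g \<le> 4 * C * norm g" for g using le[OF R0, of g] by (simp add: Q.N_zero)
  \<comment> \<open>\<open>F\<close> lives on all bounded real-linear maps into the scalars, so it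
    is cut off outside \<open>topdual sX\<close>, as \<open>dual_on\<close> requires. Its bound
    comes from the pair (0, 0) in \<open>R\<close>.\<close>
  then have "(\<lambda>g. if g \<in> topdual sX then F g else 0) \<in> dual_on (topdual sX) dscale norm"
    unfolding dual_on_def using F_le
    by (auto simp: topdual_add topdual_dscale F_add F_scl intro!: exI[of _ "4 * C"] intro: order_trans)
  then obtain x where x: "\<And>g. g \<in> topdual sX \<Longrightarrow> F g = blinfun_apply g x"
    using X_reflexive unfolding reflexive_space_def by fastforce
  \<comment> \<open>The pair of \<open>single n k\<close> and the adjoint image of \<open>k\<close>
    represents that image without error, so \<open>p\<close> is at most \<open>norm k\<close> there.
    Hence \<open>x\<close> lies in the unit ball of E.\<close>
  have L_le: "norm (L n x) \<le> 1" for n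
  proof (rule norm_L_le_dual)
    fix k assume k: "k \<in> topdual sY"
    have "norm (blinfun_apply k (L n x)) = norm (F (adjoint_op (L n) k))"
      using x[OF topdual_adjoint_op[OF L k]] by simp
    also have "\<dots> \<le> p (adjoint_op (L n) k)" by (rule F_le)
    also have "\<dots> \<le> norm k" using le[OF R_single[OF k], of "adjoint_op (L n) k" n] by (simp add: ell1_norm_single)
    finally show "norm (blinfun_apply k (L n x)) \<le> 1 * norm k" by simp
  qed simp
  have "norm x \<le> C * 1"
    using E_continuous[OF E_spaceI[OF L_le]] mult_left_mono[OF E_norm_le[OF L_le] less_imp_le[OF C_pos]]
    by linarith
  have p_f: "p f \<le> C * norm f"
  proof -
    have "p f = norm (blinfun_apply f x)" using F_f x[OF f] by simp
    also have "\<dots> \<le> norm f * norm x" by (rule norm_blinfun)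
    also have "\<dots> \<le> norm f * C" using \<open>norm x \<le> C * 1\<close> by (intro mult_left_mono) auto
    finally show ?thesis by (simp add: mult.commute)
  qed
  show thesis
  proof (cases "f = 0")
    case True
    then show thesis using that[of 0 0] R0 by (auto simp: R_def Q.N_zero)
  next
    case False
    then have "C * norm f > 0" using C_pos by simp
    \<comment> \<open>The strict inequality p(f) < 2 C norm(f), available since f \<noteq> 0, yields
      a pair of total cost below 2 C norm(f). The weight 4 C on the error then leaves an error of at
      most half of norm(f).\<close>
    then have "\<not> 2 * C * norm f \<le> p f" using p_f by linarith
    then obtain y h where yh: "(y, h) \<in> R" and less: "ell1_norm y + 4 * C * norm (f - h) < 2 * C * norm f"
      using ge[of "2 * C * norm f" f] by (meson not_le)
    have "0 \<le> ell1_norm y" "0 \<le> 4 * C * norm (f - h)"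
      using yh C_pos by (auto simp: R_def D.N_nonneg)
    with less have "ell1_norm y \<le> 2 * C * norm f" "4 * C * norm (f - h) \<le> 4 * C * (norm f / 2)"
      by auto
    then show thesis using that[of y h] yh C_pos by (auto simp: R_def)
  qed
qed

text \<open>Successive approximation as in the open mapping theorem: the residuals
  \<open>g k\<close> halve at each step, so the partial sums \<open>w k\<close> of their approximate
  representations converge. The constant 4 C is 2 C times the sum of the geometric series.\<close>

lemma representation:
  assumes f: "f \<in> topdual sX"
  obtains y where "y \<in> D" "\<And>x. x \<in> E_space L \<Longrightarrow> pairing y x = blinfun_apply f x"
    "ell1_norm y \<le> 4 * C * norm f"
proof -
  have "\<forall>g. \<exists>y h. g \<in> topdual sX \<longrightarrow> y \<in> D \<and> h \<in> topdual sX \<and>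
      (\<forall>x\<in>E_space L. pairing y x = blinfun_apply h x) \<and>
      ell1_norm y \<le> 2 * C * norm g \<and> norm (g - h) \<le> norm g / 2"
    using approx_representation by metis
  then obtain Y H where YH: "\<And>g. g \<in> topdual sX \<Longrightarrow> Y g \<in> D \<and> H g \<in> topdual sX \<and>
      (\<forall>x\<in>E_space L. pairing (Y g) x = blinfun_apply (H g) x) \<and>
      ell1_norm (Y g) \<le> 2 * C * norm g \<and> norm (g - H g) \<le> norm g / 2"
    by metis
  define g where "g k = ((\<lambda>g. g - H g) ^^ k) f" for k
  have g_0: "g 0 = f" by (simp add: g_def)
  have g_Suc: "g (Suc k) = g k - H (g k)" for k by (simp add: g_def)
  have g_in: "g k \<in> topdual sX" for k
    by (induction k) (auto simp: g_0 g_Suc f YH topdual_diff)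
  have g_norm: "norm (g k) \<le> norm f * (1/2)^k" for k
  proof (induction k)
    case (Suc k)
    have "norm (g (Suc k)) \<le> norm (g k) / 2" using YH[OF g_in[of k]] by (simp add: g_Suc)
    with Suc show ?case by simp
  qed (simp add: g_def)
  define w where "w k = (\<Sum>j<k. Y (g j))" for k
  have w_0: "w 0 = 0" and w_Suc: "w (Suc k) = w k + Y (g k)" for k by (simp_all add: w_def)
  have w: "w k \<in> D" for k
    by (induction k) (auto simp only: w_0 w_Suc Q.zero_in D.add_closed YH g_in)
  have w_step: "w (Suc k) + ell1_scale dscale (- 1) (w k) = Y (g k)" for k
    unfolding Q.minus_one_scl[OF w] by (simp add: w_Suc)
  have step: "ell1_norm (w (Suc k) + ell1_scale dscale (- 1) (w k)) \<le> (2 * C * norm f) * (1/2)^k" for k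
  proof -
    have "ell1_norm (Y (g k)) \<le> 2 * C * norm (g k)" using YH[OF g_in] by blast
    also have "\<dots> \<le> 2 * C * (norm f * (1/2)^k)" using C_pos g_norm[of k] by simp
    finally show ?thesis by (simp add: w_step mult.assoc)
  qed
  \<comment> \<open>The sum telescopes: \<open>w k\<close> represents f minus the residual
    \<open>g k\<close> on E.\<close>
  have w_pairing: "pairing (w k) x = blinfun_apply f x - blinfun_apply (g k) x" if x: "x \<in> E_space L" for k x
  proof (induction k)
    case 0
    then show ?case by (simp add: w_0 g_0 pairing_def)
  next
    case (Suc k)
    have "pairing (w (Suc k)) x = pairing (w k) x + pairing (Y (g k)) x"
      using w[of k] YH[OF g_in[of k]] x by (simp add: w_Suc pairing_add)
    with Suc show ?case using YH[OF g_in[of k]] x by (simp add: g_Suc blinfun.diff_left)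
  qed
  obtain v where v: "v \<in> D" and "(\<lambda>n. ell1_norm (w n + ell1_scale dscale (- 1) v)) \<longlonglongrightarrow> 0"
    using D.geometric_convergent[OF w step] by blast
  then have lim: "(\<lambda>n. ell1_norm (w n - v)) \<longlonglongrightarrow> 0" by (simp add: Q.minus_one_scl)
  have N_minus: "ell1_norm (v - w n) = ell1_norm (w n - v)" for n
    by (simp add: ell1_norm_def norm_minus_commute)
  show thesis
  proof
    show "v \<in> D" by (rule v)
    fix x assume x: "x \<in> E_space L"
    have "(\<lambda>n. pairing (w n) x) \<longlonglongrightarrow> pairing v x"
    proof (rule Lim_null[THEN iffD2], rule Lim_null_comparison)
      show "\<forall>\<^sub>F n in sequentially. norm (pairing (w n) x - pairing v x) \<le> E_norm L x * ell1_norm (w n - v)"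
        using norm_pairing_le[OF Q.diff_in[OF w v] x] by (simp add: pairing_diff w v x)
      show "(\<lambda>n. E_norm L x * ell1_norm (w n - v)) \<longlonglongrightarrow> 0"
        using tendsto_mult_left[OF lim, of "E_norm L x"] by simp
    qed
    moreover have "(\<lambda>n. pairing (w n) x) \<longlonglongrightarrow> blinfun_apply f x"
    proof (rule Lim_null[THEN iffD2], rule Lim_null_comparison)
      have "norm (blinfun_apply (g n) x) \<le> norm f * (1/2)^n * norm x" for n
        using norm_blinfun[of "g n" x] mult_right_mono[OF g_norm[of n] norm_ge_zero[of x]] by linarith
      then show "\<forall>\<^sub>F n in sequentially. norm (pairing (w n) x - blinfun_apply f x) \<le> norm f * (1/2)^n * norm x"
        by (simp add: w_pairing x)
      have "(\<lambda>n. norm f * (1/2)^n * norm x) \<longlonglongrightarrow> norm f * 0 * norm x"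
        by (intro tendsto_intros LIMSEQ_realpow_zero) auto
      then show "(\<lambda>n. norm f * (1/2)^n * norm x) \<longlonglongrightarrow> 0" by simp
    qed
    ultimately show "pairing v x = blinfun_apply f x" by (rule LIMSEQ_unique)
  next
    have "ell1_norm v \<le> 4 * C * norm f + ell1_norm (w n - v)" for n
    proof -
      have "ell1_norm (w n) \<le> 4 * C * norm f"
        using D.N_geometric_le[OF w step, of 0 n]
        unfolding Q.minus_one_scl[OF w] unfolding w_0 minus_zero add_0_right by simp
      moreover have "ell1_norm v \<le> ell1_norm (w n) + ell1_norm (w n - v)"
        using D.N_triangle[OF w Q.diff_in[OF v w], of n n] by (simp add: N_minus)
      ultimately show ?thesis by simp
    qed
    then have "ell1_norm v \<le> 4 * C * norm f + 0"
      by (intro tendsto_lowerbound[OF tendsto_add[OF tendsto_const lim]]) auto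
    then show "ell1_norm v \<le> 4 * C * norm f" by simp
  qed
qed

section \<open>The isometry from E onto the dual of the quotient\<close>

abbreviation coset :: "(nat \<Rightarrow> 'y \<Rightarrow>\<^sub>L 'k) \<Rightarrow> (nat \<Rightarrow> 'y \<Rightarrow>\<^sub>L 'k) set"
  where "coset y \<equiv> y +o P_space sY L"

abbreviation qnorm :: "(nat \<Rightarrow> 'y \<Rightarrow>\<^sub>L 'k) set \<Rightarrow> real"
  where "qnorm \<equiv> quot_norm ell1_norm"

abbreviation predual_dual :: "((nat \<Rightarrow> 'y \<Rightarrow>\<^sub>L 'k) set \<Rightarrow> 'k) set"
  where "predual_dual \<equiv> dual_on (predual sY L) (predual_scale sY L) qnorm"

lemma predualE:
  assumes "A \<in> predual sY L"
  obtains y where "y \<in> D" "A = coset y"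
  using assms unfolding predual_def by (rule Q.quot_spaceE)

lemma coset_in_predual: "y \<in> D \<Longrightarrow> coset y \<in> predual sY L"
  unfolding predual_def by (rule Q.coset_in)

lemma predual_scale_coset: "y \<in> D \<Longrightarrow> predual_scale sY L c (coset y) = coset (ell1_scale dscale c y)"
  unfolding predual_scale_def by (rule Q.coset_scale)

lemma coset_eqI:
  assumes "y \<in> D" "z \<in> D" "\<And>x. x \<in> E_space L \<Longrightarrow> pairing y x = pairing z x"
  shows "coset y = coset z"
  unfolding Q.coset_eq_iff P_space_iff using assms by (simp add: Q.diff_in pairing_diff)

text \<open>Sequences with one nonzero entry give L n x = L n x' for every n. The continuous
  embedding of E into X then forces x = x'.\<close>

lemma E_eqI:
  assumes x: "x \<in> E_space L" and x': "x' \<in> E_space L" and eq: "\<And>y. y \<in> D \<Longrightarrow> pairing y x = pairing y x'"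
  shows "x = x'"
proof -
  have "L n x = L n x'" for n
  proof -
    have "norm (L n (x - x')) \<le> 0"
    proof (rule norm_L_le_dual)
      fix f assume "f \<in> topdual sY"
      then have "blinfun_apply f (L n x) = blinfun_apply f (L n x')"
        using eq[OF single_in, of f n] by (simp add: pairing_single)
      then show "norm (blinfun_apply f (L n (x - x'))) \<le> 0 * norm f" by (simp add: blinfun.diff_right)
    qed simp
    then show ?thesis by (simp add: blinfun.diff_right)
  qed
  then have L0: "norm (L n (x - x')) \<le> 0" for n by (simp add: blinfun.diff_right)
  have "norm (x - x') \<le> C * 0"
    using E_continuous[OF E_spaceI[OF L0]] mult_left_mono[OF E_norm_le[OF L0] less_imp_le[OF C_pos]]
    by linarith
  then show ?thesis by simp
qed

text \<open>The chosen representative is immaterial for \<open>x\<close> in E, because elements of P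
  pair to 0 with E. The value 0 off the carrier matches the convention of
  \<open>dual_on\<close>.\<close>

definition J :: "'x \<Rightarrow> (nat \<Rightarrow> 'y \<Rightarrow>\<^sub>L 'k) set \<Rightarrow> 'k"
  where "J x A = (if A \<in> predual sY L then pairing (SOME y. y \<in> D \<and> A = coset y) x else 0)"

lemma J_coset:
  assumes y: "y \<in> D" and x: "x \<in> E_space L"
  shows "J x (coset y) = pairing y x"
proof -
  define z where "z = (SOME z. z \<in> D \<and> coset y = coset z)"
  have z: "z \<in> D" "coset y = coset z"
    using someI[of "\<lambda>z. z \<in> D \<and> coset y = coset z" y] y by (auto simp: z_def)
  then have "y - z \<in> P_space sY L" by (simp add: Q.coset_eq_iff)
  then have "pairing y x = pairing z x" using x z y by (simp add: P_space_iff pairing_diff)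
  then show ?thesis using coset_in_predual[OF y] by (simp add: J_def z_def)
qed

lemma norm_J_le:
  assumes x: "x \<in> E_space L" and A: "A \<in> predual sY L"
  shows "norm (J x A) \<le> E_norm L x * qnorm A"
proof -
  obtain y where y: "y \<in> D" "A = coset y" using A by (rule predualE)
  have E: "E_norm L x \<ge> 0" using x by (rule E.N_nonneg)
  have le: "norm (pairing y x) \<le> E_norm L x * ell1_norm (y + p)" if p: "p \<in> P_space sY L" for p
    using norm_pairing_le[of "y + p" x] p x y
    by (simp add: P_space_iff pairing_add D.add_closed)
  have "norm (pairing y x) \<le> E_norm L x * qnorm A"
  proof (cases "E_norm L x = 0")
    case True
    then show ?thesis using le[OF Q.P_zero] by simp
  next
    case False
    with E have E: "E_norm L x > 0" by simp
    have "norm (pairing y x) / E_norm L x \<le> qnorm A"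
      unfolding y(2) by (rule Q.quot_norm_ge) (use le E in \<open>simp add: field_simps\<close>)
    then show ?thesis using E by (simp add: field_simps)
  qed
  then show ?thesis by (simp add: y J_coset x)
qed

lemma J_in_dual:
  assumes x: "x \<in> E_space L"
  shows "J x \<in> predual_dual"
  unfolding dual_on_def
proof (intro CollectI conjI ballI allI impI)
  fix A B assume "A \<in> predual sY L" "B \<in> predual sY L"
  then obtain y z where "y \<in> D" "A = coset y" "z \<in> D" "B = coset z" by (metis predualE)
  then show "J x (A + B) = J x A + J x B"
    by (simp add: Q.coset_add J_coset x pairing_add D.add_closed)
next
  fix c A assume "A \<in> predual sY L"
  then obtain y where "y \<in> D" "A = coset y" by (rule predualE)
  then show "J x (predual_scale sY L c A) = c * J x A"
    by (simp add: predual_scale_coset J_coset x pairing_scale D.scl_closed)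
next
  show "\<exists>B. \<forall>A\<in>predual sY L. norm (J x A) \<le> B * qnorm A"
    using norm_J_le[OF x] by blast
next
  show "J x A = 0" if "A \<notin> predual sY L" for A using that by (simp add: J_def)
qed

text \<open>For the lower bound, \<open>J x\<close> is tested on the coset of
  \<open>single n f\<close> with \<open>f\<close> norming for \<open>L n x\<close>; passing to the
  coset does not increase the norm, so it lies in the unit ball.\<close>

lemma J_dual_norm:
  assumes x: "x \<in> E_space L"
  shows "dual_norm_on (predual sY L) qnorm (J x) = E_norm L x"
proof (rule antisym)
  \<comment> \<open>The supremum is taken over a nonempty set.\<close>
  have zero: "coset 0 \<in> {A \<in> predual sY L. qnorm A \<le> 1}"
    using Q.quot_norm_le_N[OF Q.zero_in] coset_in_predual[OF Q.zero_in]
    unfolding Q.N_zero mem_Collect_eq by linarith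
  have bound: "norm (J x A) \<le> E_norm L x" if "A \<in> predual sY L" "qnorm A \<le> 1" for A
    using norm_J_le[OF x that(1)] mult_left_mono[OF that(2) E.N_nonneg[OF x]] by simp
  show "dual_norm_on (predual sY L) qnorm (J x) \<le> E_norm L x"
    unfolding dual_norm_on_def using zero bound by (intro cSUP_least) blast+
  show "E_norm L x \<le> dual_norm_on (predual sY L) qnorm (J x)"
  proof (rule E_norm_le)
    fix n
    obtain f where f: "f \<in> topdual sY" "norm f \<le> 1" "norm (blinfun_apply f (L n x)) = norm (L n x)"
      by (rule Y.norming_functional)
    have "norm (J x (coset (single n f))) \<le> dual_norm_on (predual sY L) qnorm (J x)"
      unfolding dual_norm_on_def
    proof (rule cSUP_upper)
      show "coset (single n f) \<in> {A \<in> predual sY L. qnorm A \<le> 1}"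
        using Q.quot_norm_le_N[OF single_in[OF f(1)], of n] f
        by (simp add: coset_in_predual single_in ell1_norm_single)
      show "bdd_above ((\<lambda>A. norm (J x A)) ` {A \<in> predual sY L. qnorm A \<le> 1})"
        using bound by (auto intro!: bdd_aboveI2)
    qed
    then show "norm (L n x) \<le> dual_norm_on (predual sY L) qnorm (J x)"
      by (simp add: J_coset single_in f x pairing_single)
  qed
qed

lemma J_add:
  assumes "x \<in> E_space L" "x' \<in> E_space L"
  shows "J (x + x') = J x + J x'"
proof
  show "J (x + x') A = (J x + J x') A" for A
  proof (cases "A \<in> predual sY L")
    case True
    then obtain y where "y \<in> D" "A = coset y" by (rule predualE)
    then show ?thesis using assms by (simp add: J_coset E.add_closed pairing_add_right)
  qed (simp add: J_def)
qed

lemma J_scale: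
  assumes "x \<in> E_space L"
  shows "J (sX c x) = (\<lambda>A. c * J x A)"
proof
  show "J (sX c x) A = c * J x A" for A
  proof (cases "A \<in> predual sY L")
    case True
    then obtain y where "y \<in> D" "A = coset y" by (rule predualE)
    then show ?thesis using assms by (simp add: J_coset E.scl_closed pairing_scale_right)
  qed (simp add: J_def)
qed

lemma dual_represented:
  assumes \<phi>: "\<phi> \<in> predual_dual"
  obtains x where "x \<in> E_space L" "\<And>y. y \<in> D \<Longrightarrow> \<phi> (coset y) = pairing y x"
proof -
  have \<phi>_add: "\<phi> (coset (y + z)) = \<phi> (coset y) + \<phi> (coset z)" if "y \<in> D" "z \<in> D" for y z
    using \<phi> that coset_in_predual unfolding dual_on_def by (simp flip: Q.coset_add)
  have \<phi>_scale: "\<phi> (coset (ell1_scale dscale c y)) = c * \<phi> (coset y)" if "y \<in> D" for c y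
    using \<phi> that coset_in_predual unfolding dual_on_def by (simp flip: predual_scale_coset)
  obtain B where B: "B \<ge> 0" "\<And>y. y \<in> D \<Longrightarrow> norm (\<phi> (coset y)) \<le> B * ell1_norm y"
  proof -
    obtain B where B: "\<And>A. A \<in> predual sY L \<Longrightarrow> norm (\<phi> A) \<le> B * qnorm A"
      using \<phi> unfolding dual_on_def by blast
    \<comment> \<open>A bound in \<open>dual_on\<close> carries no sign, but
      \<open>norm_L_le_dual\<close> needs a nonnegative one.\<close>
    have "norm (\<phi> (coset y)) \<le> \<bar>B\<bar> * ell1_norm y" if y: "y \<in> D" for y
    proof -
      have "norm (\<phi> (coset y)) \<le> B * qnorm (coset y)" using B coset_in_predual[OF y] by blast
      also have "\<dots> \<le> \<bar>B\<bar> * qnorm (coset y)"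
        using Q.quot_norm_nonneg[OF y] by (intro mult_right_mono) auto
      also have "\<dots> \<le> \<bar>B\<bar> * ell1_norm y"
        using Q.quot_norm_le_N[OF y] by (intro mult_left_mono) auto
      finally show ?thesis .
    qed
    then show thesis using that[of "\<bar>B\<bar>"] by simp
  qed
  have "\<exists>y. y \<in> D \<and> (\<forall>x\<in>E_space L. pairing y x = blinfun_apply f x) \<and> ell1_norm y \<le> 4 * C * norm f"
    if "f \<in> topdual sX" for f using representation[OF that] by metis
  then obtain r where r: "\<And>f. f \<in> topdual sX \<Longrightarrow> r f \<in> D"
      "\<And>f x. f \<in> topdual sX \<Longrightarrow> x \<in> E_space L \<Longrightarrow> pairing (r f) x = blinfun_apply f x"
      "\<And>f. f \<in> topdual sX \<Longrightarrow> ell1_norm (r f) \<le> 4 * C * norm f"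
    by metis
  define \<Phi> where "\<Phi> f = (if f \<in> topdual sX then \<phi> (coset (r f)) else 0)" for f
  have "\<Phi> \<in> dual_on (topdual sX) dscale norm"
    unfolding dual_on_def
  proof (intro CollectI conjI ballI allI impI)
    fix f g :: "'x \<Rightarrow>\<^sub>L 'k" assume f: "f \<in> topdual sX" and g: "g \<in> topdual sX"
    \<comment> \<open>The choice \<open>r\<close> need not be linear. Sequences that represent the
      same functional on E share a coset, which makes \<Phi> linear.\<close>
    have "coset (r (f + g)) = coset (r f + r g)"
      using f g by (intro coset_eqI) (simp_all add: r topdual_add D.add_closed pairing_add blinfun.add_left)
    then show "\<Phi> (f + g) = \<Phi> f + \<Phi> g"
      using f g by (simp add: \<Phi>_def topdual_add \<phi>_add r)
  next
    fix c and f :: "'x \<Rightarrow>\<^sub>L 'k" assume f: "f \<in> topdual sX"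
    have "coset (r (dscale c f)) = coset (ell1_scale dscale c (r f))"
      using f by (intro coset_eqI) (simp_all add: r topdual_dscale D.scl_closed pairing_scale)
    then show "\<Phi> (dscale c f) = c * \<Phi> f"
      using f by (simp add: \<Phi>_def topdual_dscale \<phi>_scale r)
  next
    have "norm (\<Phi> f) \<le> (B * (4 * C)) * norm f" if f: "f \<in> topdual sX" for f
    proof -
      have "norm (\<Phi> f) \<le> B * ell1_norm (r f)" using f by (simp add: \<Phi>_def B r)
      also have "\<dots> \<le> B * (4 * C * norm f)" using f B(1) r(3) by (intro mult_left_mono)
      finally show ?thesis by (simp add: mult.assoc)
    qed
    then show "\<exists>B. \<forall>f\<in>topdual sX. norm (\<Phi> f) \<le> B * norm f" by blast
  next
    show "\<Phi> f = 0" if "f \<notin> topdual sX" for f using that by (simp add: \<Phi>_def)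
  qed
  then obtain x where x: "\<forall>f\<in>topdual sX. \<Phi> f = blinfun_apply f x"
    using X_reflexive unfolding reflexive_space_def by blast
  \<comment> \<open>Both \<open>single n k\<close> and the chosen representative of the adjoint
    image of \<open>k\<close> represent that image, so \<open>\<phi>\<close> takes the same value on
    their cosets, namely its evaluation at \<open>x\<close>.\<close>
  have \<phi>_single: "\<phi> (coset (single n k)) = blinfun_apply k (L n x)" if k: "k \<in> topdual sY" for n k
  proof -
    have adj: "adjoint_op (L n) k \<in> topdual sX" by (rule topdual_adjoint_op[OF L k])
    then have "coset (single n k) = coset (r (adjoint_op (L n) k))"
      using k by (intro coset_eqI) (simp_all add: r single_in pairing_single)
    then show ?thesis using x adj by (simp add: \<Phi>_def)
  qed
  have L_le: "norm (L n x) \<le> B" for n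
  proof (rule norm_L_le_dual[OF _ B(1)])
    fix k assume k: "k \<in> topdual sY"
    show "norm (blinfun_apply k (L n x)) \<le> B * norm k"
      using B(2)[OF single_in[OF k], of n] by (simp add: \<phi>_single k ell1_norm_single)
  qed
  then have xE: "x \<in> E_space L" by (rule E_spaceI)
  have "\<phi> (coset y) = pairing y x" if y: "y \<in> D" for y
  proof -
    \<comment> \<open>\<open>\<phi>\<close> and the pairing with \<open>x\<close> agree on the
      truncations of \<open>y\<close>; both are continuous in the norm of the sequence space, so
      they agree at \<open>y\<close>.\<close>
    define t where "t k = (\<Sum>n<k. single n (y n))" for k
    have y_n: "y n \<in> topdual sY" for n using y by (simp add: ell1_def)
    have t_0: "t 0 = 0" and t_Suc: "t (Suc k) = t k + single k (y k)" for k by (simp_all add: t_def)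
    have t: "t k \<in> D" for k
      by (induction k) (simp_all only: t_0 t_Suc Q.zero_in D.add_closed single_in y_n)
    have t_eq: "\<phi> (coset (t k)) = pairing (t k) x" for k
    proof (induction k)
      case 0
      have "\<phi> (coset 0) = 0"
        using \<phi>_add[OF Q.zero_in Q.zero_in] by (simp only: add_0_left add_cancel_right_right)
      moreover have "pairing 0 x = 0" by (simp add: pairing_def)
      ultimately show ?case by (simp only: t_0)
    next
      case (Suc k)
      have s: "single k (y k) \<in> D" by (rule single_in[OF y_n])
      show ?case
        unfolding t_Suc \<phi>_add[OF t s] pairing_add[OF t s xE] Suc
        by (simp add: \<phi>_single y_n pairing_single)
    qed
    have "norm (\<phi> (coset y) - pairing y x) \<le> (B + E_norm L x) * ell1_norm (y - t k)" for k
    proof -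
      have d: "y - t k \<in> D" using y t by (rule Q.diff_in)
      have "\<phi> (coset y) - pairing y x = \<phi> (coset (y - t k)) - pairing (y - t k) x"
        using \<phi>_add[OF d t[of k]] pairing_diff[OF y t xE, of k] t_eq[of k] by simp
      also have "norm \<dots> \<le> B * ell1_norm (y - t k) + E_norm L x * ell1_norm (y - t k)"
        by (intro order_trans[OF norm_triangle_ineq4] add_mono B(2) norm_pairing_le d xE)
      finally show ?thesis unfolding distrib_right .
    qed
    moreover have "(\<lambda>k. (B + E_norm L x) * ell1_norm (y - t k)) \<longlonglongrightarrow> (B + E_norm L x) * 0"
      unfolding t_def by (intro tendsto_mult_left ell1_norm_truncate_tendsto[OF y])
    ultimately have "norm (\<phi> (coset y) - pairing y x) \<le> (B + E_norm L x) * 0"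
      by (intro tendsto_lowerbound) auto
    then show ?thesis by simp
  qed
  with xE show thesis by (rule that)
qed

lemma J_isometric_iso:
  "isometric_iso_on (E_space L) sX (E_norm L) predual_dual (\<lambda>c \<phi> A. c * \<phi> A)
    (dual_norm_on (predual sY L) qnorm) J"
  unfolding isometric_iso_on_def
proof (intro conjI ballI allI)
  show "bij_betw J (E_space L) predual_dual"
  proof (rule bij_betw_imageI)
    show "inj_on J (E_space L)"
      by (intro inj_onI E_eqI) (auto simp flip: J_coset)
    have "\<phi> \<in> J ` E_space L" if \<phi>: "\<phi> \<in> predual_dual" for \<phi>
    proof -
      obtain x where x: "x \<in> E_space L" "\<And>y. y \<in> D \<Longrightarrow> \<phi> (coset y) = pairing y x"
        using dual_represented[OF \<phi>] by blast
      have "\<phi> A = J x A" for A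
      proof (cases "A \<in> predual sY L")
        case True
        then obtain y where "y \<in> D" "A = coset y" by (rule predualE)
        with x show ?thesis by (simp add: J_coset)
      next
        case False
        with \<phi> show ?thesis by (simp add: dual_on_def J_def)
      qed
      then have "\<phi> = J x" ..
      with x show ?thesis by blast
    qed
    with J_in_dual show "J ` E_space L = predual_dual" by blast
  qed
qed (auto simp: J_add J_scale J_dual_norm)

end

theorem theorem3:
  fixes sX :: "'k::{real_normed_field,euclidean_space} \<Rightarrow> 'x::banach \<Rightarrow> 'x"
    and sY :: "'k \<Rightarrow> 'y::banach \<Rightarrow> 'y"
    and L :: "nat \<Rightarrow> 'x \<Rightarrow>\<^sub>L 'y"
  assumes X: "scalar_banach sX"
    and X_reflexive: "reflexive_space sX"
    and Y: "scalar_banach sY"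
    and L: "\<And>n. scalar_linear sX sY (L n)"
    and E_banach: "banach_space_on (E_space L) sX (E_norm L)"
    and E_continuous: "\<exists>C. \<forall>x\<in>E_space L. norm x \<le> C * E_norm L x"
    and E_dense: "closure (E_space L) = UNIV"
  shows "banach_space_on (predual sY L) (predual_scale sY L) (quot_norm ell1_norm) \<and>
        (\<exists>J. isometric_iso_on
            (E_space L) sX (E_norm L)
            (dual_on (predual sY L) (predual_scale sY L) (quot_norm ell1_norm))
            (\<lambda>c \<phi> A. c * \<phi> A)
            (dual_norm_on (predual sY L) (quot_norm ell1_norm)) J \<and>
          (\<forall>x\<in>E_space L. \<forall>y\<in>ell1 (topdual sY).
            (\<lambda>n. blinfun_apply (y n) (L n x)) sums J x (y +o P_space sY L) \<and>
            (\<lambda>n. blinfun_apply (adjoint_op (L n) (y n)) x) sums J x (y +o P_space sY L))) \<and>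
        (\<forall>\<phi>\<in>dual_on (predual sY L) (predual_scale sY L) (quot_norm ell1_norm).
          \<exists>!x. x \<in> E_space L \<and>
            (\<forall>y\<in>ell1 (topdual sY). (\<lambda>n. blinfun_apply (y n) (L n x)) sums \<phi> (y +o P_space sY L)))"
proof -
  interpret E: banach_space_on "E_space L" sX "E_norm L" by (rule E_banach)
  obtain C0 where C0: "\<And>x. x \<in> E_space L \<Longrightarrow> norm x \<le> C0 * E_norm L x"
    using E_continuous by blast
  \<comment> \<open>The maximum with 1 makes the embedding constant positive.\<close>
  have "norm x \<le> max C0 1 * E_norm L x" if "x \<in> E_space L" for x
    using C0[OF that] mult_right_mono[OF max.cobounded1 E.N_nonneg[OF that], of C0 1] by simp
  then interpret predual_setting sX sY L "max C0 1"
    by (intro predual_setting.intro predual_setting_axioms.intro X Y X_reflexive L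
        E.normed_space_on_axioms) auto
  show ?thesis
  proof (intro conjI ballI exI[of _ J])
    show "banach_space_on (predual sY L) (predual_scale sY L) (quot_norm ell1_norm)"
      unfolding predual_def predual_scale_def by (rule Q.banach_space_quotient)
    show "isometric_iso_on (E_space L) sX (E_norm L) predual_dual (\<lambda>c \<phi> A. c * \<phi> A)
        (dual_norm_on (predual sY L) (quot_norm ell1_norm)) J"
      by (rule J_isometric_iso)
  next
    fix x y assume "x \<in> E_space L" "y \<in> D"
    then show "(\<lambda>n. blinfun_apply (y n) (L n x)) sums J x (coset y)"
      and "(\<lambda>n. blinfun_apply (adjoint_op (L n) (y n)) x) sums J x (coset y)"
      by (simp_all add: J_coset pairing_sums)
  next
    fix \<phi> assume "\<phi> \<in> predual_dual"
    then obtain x where x: "x \<in> E_space L" "\<And>y. y \<in> D \<Longrightarrow> \<phi> (coset y) = pairing y x"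
      using dual_represented by blast
    show "\<exists>!x. x \<in> E_space L \<and> (\<forall>y\<in>D. (\<lambda>n. blinfun_apply (y n) (L n x)) sums \<phi> (coset y))"
    proof (intro ex1I conjI ballI)
      show "x \<in> E_space L" by (rule x)
      show "(\<lambda>n. blinfun_apply (y n) (L n x)) sums \<phi> (coset y)" if "y \<in> D" for y
        using pairing_sums[OF that x(1)] x(2)[OF that] by simp
      fix x' assume x': "x' \<in> E_space L \<and> (\<forall>y\<in>D. (\<lambda>n. blinfun_apply (y n) (L n x')) sums \<phi> (coset y))"
      show "x' = x"
      \<comment> \<open>Uniqueness of sums makes the pairings of \<open>x'\<close> and
        \<open>x\<close> with every sequence equal.\<close>
      proof (rule E_eqI)
        show "pairing y x' = pairing y x" if "y \<in> D" for y
          using x' x(2)[OF that] that by (auto simp: pairing_def sums_iff)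
      qed (use x x' in auto)
    qed
  qed
qed

end
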